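(* Let $X$ be a strong PP-space, let $Y$ be a topological space, and let $Z$ be a contractible regular strongly $\sigma$-metrizable space with a stratification $(Z_n)_{n=1}^\infty$, where $Z_n$ is a metrizable separable arcwise connected and locally arcwise connected space for every $n\in\mathbb N$. Then every vertically nearly separately continuous mapping $f:X\times Y\to Z$ is of the first Baire class, i.e. $$C\overline{C}(X\times Y,Z)\subseteq B_1(X\times Y,Z).$$
   Context: For topological spaces $S,T$, $C(S,T)$ is the set of continuous mappings $S\to T$, and $B_1(S,T)$ (first Baire class) is the set of mappings $S\to T$ that are pointwise limits of a sequence of mappings from $C(S,T)$. For $f:X\times Y\to Z$ write $f^x(y)=f_y(x)=f(x,y)$. The mapping $f$ is vertically nearly separately continuous, $f\in C\overline{C}(X\times Y,Z)$, if $f_y\in C(X,Z)$ for every $y\in Y$ and there is a dense set $D\subseteq X$ such that $f^x\in C(Y,Z)$ for all $x\in D$. A co-zero set in $X$ is a set of the form $g^{-1}((0,1])$ with $g:X\to[0,1]$ continuous. A topological space $X$ is a strong PP-space if for every dense set $D\subseteq X$ there exist a sequence $((U_{i,n}:i\in I_n))_{n=1}^\infty$ of locally finite covers of $X$ by co-zero sets $U_{i,n}$ and a sequence $((x_{i,n}:i\in I_n))_{n=1}^\infty$ of families of points of $D$ such that for every $x\in X$ and every sequence of indices $i_n\in I_n$ with $x\in U_{i_n,n}$ for all $n\in\mathbb N$, one has $x_{i_n,n}\to x$. A space $Z$ is contractible if there exist $z^*\in Z$ and a continuous function $\gamma:Z\times[0,1]\to Z$ such that $\gamma(z,0)=z$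 and $\gamma(z,1)=z^*$ for all $z\in Z$. A space $Z$ is $\sigma$-metrizable with a stratification $(Z_n)_{n=1}^\infty$ if $Z=\bigcup_{n=1}^\infty Z_n$, where $(Z_n)_{n=1}^\infty$ is an increasing sequence of closed metrizable subspaces of $Z$. It is strongly $\sigma$-metrizable with the stratification $(Z_n)_{n=1}^\infty$ if, moreover, for every convergent sequence $(z_k)_{k=1}^\infty$ in $Z$ there exists $n$ such that $\{z_k:k\in\mathbb N\}\subseteq Z_n$. *)

theory Defs
  imports "HOL-Analysis.Analysis"
begin

text \<open>
  Spaces are values of type \<open>'a topology\<close>, and mappings are total HOL functions of which only the
  values on the carrier matter. Sequences are indexed from \<open>0\<close> instead of \<open>1\<close>.
\<close>

definition baire_one :: "'a topology \<Rightarrow> 'b topology \<Rightarrow> ('a \<Rightarrow> 'b) set" where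
  "baire_one S T = {f. \<exists>F :: nat \<Rightarrow> 'a \<Rightarrow> 'b. (\<forall>n. continuous_map S T (F n)) \<and>
      (\<forall>s \<in> topspace S. limitin T (\<lambda>n. F n s) (f s) sequentially)}"

definition vertically_nearly_separately_continuous ::
    "'a topology \<Rightarrow> 'b topology \<Rightarrow> 'c topology \<Rightarrow> ('a \<times> 'b \<Rightarrow> 'c) set" where
  "vertically_nearly_separately_continuous X Y Z =
     {f. (\<forall>y \<in> topspace Y. continuous_map X Z (\<lambda>x. f (x, y))) \<and>
         (\<exists>D \<subseteq> topspace X. X closure_of D = topspace X \<and>
            (\<forall>x \<in> D. continuous_map Y Z (\<lambda>y. f (x, y))))}"

definition cozero_in :: "'a topology \<Rightarrow> 'a set \<Rightarrow> bool" where
  "cozero_in X U \<longleftrightarrow> (\<exists>g :: 'a \<Rightarrow> real. continuous_map X (top_of_set {0..1}) g \<and>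
      U = {x \<in> topspace X. g x \<in> {0<..1}})"

text \<open>
  Unlike \<^const>\<open>locally_finite_in\<close>, which concerns sets of sets, this counts indices, so that a
  nonempty set may be repeated only finitely often.
\<close>
definition locally_finite_family :: "'a topology \<Rightarrow> 'i set \<Rightarrow> ('i \<Rightarrow> 'a set) \<Rightarrow> bool" where
  "locally_finite_family X I U \<longleftrightarrow> (\<forall>i \<in> I. U i \<subseteq> topspace X) \<and>
     (\<forall>x \<in> topspace X. \<exists>V. openin X V \<and> x \<in> V \<and> finite {i \<in> I. U i \<inter> V \<noteq> {}})"

definition strong_PP_system ::
    "'a topology \<Rightarrow> 'a set \<Rightarrow> (nat \<Rightarrow> 'i set) \<Rightarrow> (nat \<Rightarrow> 'i \<Rightarrow> 'a set) \<Rightarrow> (nat \<Rightarrow> 'i \<Rightarrow> 'a) \<Rightarrow> bool" where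
  "strong_PP_system X D I U p \<longleftrightarrow>
     (\<forall>n. locally_finite_family X (I n) (U n) \<and> (\<Union>i \<in> I n. U n i) = topspace X \<and>
          (\<forall>i \<in> I n. cozero_in X (U n i) \<and> p n i \<in> D)) \<and>
     (\<forall>x \<in> topspace X. \<forall>s :: nat \<Rightarrow> 'i. (\<forall>n. s n \<in> I n \<and> x \<in> U n (s n)) \<longrightarrow>
          limitin X (\<lambda>n. p n (s n)) x sequentially)"

text \<open>
  The index sets have to live in some type. Taking \<open>'a \<times> nat\<close> loses no generality:
  see \<open>strong_PP_system_reindex\<close>.
\<close>
definition strong_PP_space :: "'a topology \<Rightarrow> bool" where
  "strong_PP_space X \<longleftrightarrow> (\<forall>D \<subseteq> topspace X. X closure_of D = topspace X \<longrightarrow>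
     (\<exists>(I :: nat \<Rightarrow> ('a \<times> nat) set) U p. strong_PP_system X D I U p))"

lemma strong_PP_system_reindex:
  fixes X :: "'a topology" and I :: "nat \<Rightarrow> 'i set"
  assumes sys: "strong_PP_system X D I U p"
  shows "\<exists>(I' :: nat \<Rightarrow> ('a \<times> nat) set) U' p'. strong_PP_system X D I' U' p'"
proof -
  define J where "J n = {i \<in> I n. U n i \<noteq> {}}" for n
  have lf: "locally_finite_family X (I n) (U n)"
    and cov: "(\<Union>i \<in> I n. U n i) = topspace X"
    and coz: "\<And>i. i \<in> I n \<Longrightarrow> cozero_in X (U n i) \<and> p n i \<in> D" for n
    using sys by (auto simp: strong_PP_system_def)
  have lim: "limitin X (\<lambda>n. p n (s n)) x sequentially"
    if "x \<in> topspace X" "\<And>n. s n \<in> I n \<and> x \<in> U n (s n)" for x s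
    using sys that unfolding strong_PP_system_def by blast
  have fin: "finite {i \<in> I n. x \<in> U n i}" for n x
  proof (cases "x \<in> topspace X")
    case True
    then obtain V where V: "x \<in> V" "finite {i \<in> I n. U n i \<inter> V \<noteq> {}}"
      using lf[of n] unfolding locally_finite_family_def by blast
    show ?thesis by (rule finite_subset[OF _ V(2)]) (use V(1) in auto)
  next
    case False
    then have "{i \<in> I n. x \<in> U n i} = {}" using cov[of n] by auto
    then show ?thesis by (simp only: finite.emptyI)
  qed
  have "\<exists>e :: 'i \<Rightarrow> nat. inj_on e {i \<in> I n. x \<in> U n i}" for n x
    using finite_imp_inj_to_nat_seg[OF fin[of n x]] by blast
  then obtain e :: "nat \<Rightarrow> 'a \<Rightarrow> 'i \<Rightarrow> nat" where e: "\<And>n x. inj_on (e n x) {i \<in> I n. x \<in> U n i}"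
    by metis
  define c where "c n i = (SOME x. x \<in> U n i)" for n i
  have c: "c n i \<in> U n i" if "i \<in> J n" for n i
    using that some_in_eq[of "U n i"] unfolding c_def J_def by simp
  define h where "h n i = (c n i, e n (c n i) i)" for n i
  have inj: "inj_on (h n) (J n)" for n
  proof (rule inj_onI)
    fix i j assume ij: "i \<in> J n" "j \<in> J n" "h n i = h n j"
    then have eq: "c n i = c n j" "e n (c n i) i = e n (c n i) j" by (auto simp: h_def)
    have "i \<in> {k \<in> I n. c n i \<in> U n k}" "j \<in> {k \<in> I n. c n i \<in> U n k}"
      using ij(1,2) c[OF ij(1)] c[OF ij(2)] eq(1) by (auto simp: J_def)
    then show "i = j" using e[of n "c n i"] eq(2) by (meson inj_onD)
  qed
  define g where "g n = inv_into (J n) (h n)" for n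
  have gh: "g n (h n i) = i" if "i \<in> J n" for n i
    using that inj by (simp add: g_def)
  have gJ: "g n k \<in> J n" if "k \<in> h n ` J n" for n k
    using that gh by auto
  have "strong_PP_system X D (\<lambda>n. h n ` J n) (\<lambda>n k. U n (g n k)) (\<lambda>n k. p n (g n k))"
    unfolding strong_PP_system_def
  proof (intro conjI allI ballI impI)
    fix n
    show "locally_finite_family X (h n ` J n) (\<lambda>k. U n (g n k))"
      unfolding locally_finite_family_def
    proof (intro conjI ballI)
      fix k assume "k \<in> h n ` J n"
      then show "U n (g n k) \<subseteq> topspace X"
        using gJ[of k n] lf[of n] by (auto simp: J_def locally_finite_family_def)
    next
      fix x assume "x \<in> topspace X"
      then obtain V where V: "openin X V" "x \<in> V" "finite {i \<in> I n. U n i \<inter> V \<noteq> {}}"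
        using lf[of n] unfolding locally_finite_family_def by blast
      have "{k \<in> h n ` J n. U n (g n k) \<inter> V \<noteq> {}} \<subseteq> h n ` {i \<in> I n. U n i \<inter> V \<noteq> {}}"
      proof
        fix k assume "k \<in> {k \<in> h n ` J n. U n (g n k) \<inter> V \<noteq> {}}"
        then obtain i where i: "i \<in> J n" "k = h n i" "U n (g n k) \<inter> V \<noteq> {}" by blast
        then have "U n i \<inter> V \<noteq> {}" using gh[of i n] by simp
        with i show "k \<in> h n ` {i \<in> I n. U n i \<inter> V \<noteq> {}}" by (simp add: J_def)
      qed
      then have "finite {k \<in> h n ` J n. U n (g n k) \<inter> V \<noteq> {}}"
        using V(3) by (meson finite_imageI finite_subset)
      with V(1,2)
      show "\<exists>V. openin X V \<and> x \<in> V \<and> finite {k \<in> h n ` J n. U n (g n k) \<inter> V \<noteq> {}}" by blast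
    qed
    have "(\<Union>k \<in> h n ` J n. U n (g n k)) = (\<Union>i \<in> J n. U n i)" using gh by simp
    also have "\<dots> = topspace X" unfolding cov[of n, symmetric] by (auto simp: J_def)
    finally show "(\<Union>k \<in> h n ` J n. U n (g n k)) = topspace X" .
    fix k assume "k \<in> h n ` J n"
    then have "g n k \<in> I n" using gJ[of k n] by (auto simp: J_def)
    then show "cozero_in X (U n (g n k))" "p n (g n k) \<in> D" using coz by blast+
  next
    fix x and s :: "nat \<Rightarrow> 'a \<times> nat"
    assume "x \<in> topspace X" "\<forall>n. s n \<in> h n ` J n \<and> x \<in> U n (g n (s n))"
    moreover from this(2) have "g n (s n) \<in> I n" for n using gJ[of "s n" n] by (auto simp: J_def)
    ultimately show "limitin X (\<lambda>n. p n (g n (s n))) x sequentially" by (intro lim) auto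
  qed
  then show ?thesis by blast
qed

definition sigma_metrizable :: "'a topology \<Rightarrow> (nat \<Rightarrow> 'a set) \<Rightarrow> bool" where
  "sigma_metrizable Z Zs \<longleftrightarrow> topspace Z = (\<Union>n. Zs n) \<and> (\<forall>n. Zs n \<subseteq> Zs (Suc n)) \<and>
     (\<forall>n. closedin Z (Zs n) \<and> metrizable_space (subtopology Z (Zs n)))"

text \<open>
  The range condition on \<open>z\<close> is needed: \<^const>\<open>limitin\<close> only constrains a sequence eventually.
\<close>
definition strongly_sigma_metrizable :: "'a topology \<Rightarrow> (nat \<Rightarrow> 'a set) \<Rightarrow> bool" where
  "strongly_sigma_metrizable Z Zs \<longleftrightarrow> sigma_metrizable Z Zs \<and>
     (\<forall>z :: nat \<Rightarrow> 'a. range z \<subseteq> topspace Z \<and> (\<exists>l. limitin Z z l sequentially) \<longrightarrow>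
        (\<exists>n. range z \<subseteq> Zs n))"

end

theory Submission
  imports Defs
begin

text \<open>
  Fix a system of covers \<open>U n i\<close> and points \<open>p n i\<close> for the dense set of continuity of \<open>f\<close>, and call the
  maps \<open>y \<mapsto> f (p n i, y)\<close> with \<open>x \<in> U n i\<close> the samples at \<open>x\<close>; they converge to \<open>f (x, y)\<close> however the
  indices are chosen. As \<open>Z\<close> is regular and hereditarily Lindelof, its open sets are co-zero sets.
  Local finiteness then makes
  \<open>{(x, y). all samples lie in the m-th stratum}\<close> a zero set \<open>A m\<close> of the product, and makes preimages of
  open sets countable unions of zero sets. Since the stratification is strong, the sets \<open>A m\<close> cover
  the product, and \<open>f\<close> maps \<open>A m\<close> into the \<open>m\<close>-th stratum \<open>M\<close>.

  On \<open>A m\<close> the map is a pointwise limit of continuous maps into \<open>M\<close>: cover \<open>M\<close> for every \<open>n\<close> by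
  countably many path connected sets of diameter at most \<open>2\<^sup>-\<^sup>n\<close>, pick a point in each, and approximate \<open>f\<close>
  by maps that successively move along short paths from a point of level \<open>n\<close> to one of level \<open>n + 1\<close>.
  Finally, a contraction of \<open>Z\<close> extends a continuous map given on finitely many disjoint zero sets
  to the whole product, which glues the approximations belonging to different strata.
\<close>

subsection \<open>Zero sets and co-zero sets\<close>

text \<open>Balls of radius \<open>1 / real (Suc n)\<close> around the points of a countable dense
  set form a base.\<close>

lemma separable_metrizable_imp_second_countable:
  assumes "metrizable_space M" "separable_space M"
  shows "second_countable M"
proof -
  obtain A d where "Metric_space A d" and M: "M = Metric_space.mtopology A d"
    using assms(1) by (auto simp: metrizable_space_def)
  interpret Metric_space A d by fact
  obtain C where C: "countable C" "C \<subseteq> A" "mtopology closure_of C = A"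
    using assms(2) by (auto simp: separable_space_def M)
  define B where "B = (\<lambda>(c, n). mball c (1 / real (Suc n))) ` (C \<times> UNIV)"
  have "\<exists>V\<in>B. x \<in> V \<and> V \<subseteq> U" if U: "openin mtopology U" "x \<in> U" for U x
  proof -
    obtain r where r: "r > 0" "mball x r \<subseteq> U" and x: "x \<in> A"
      using U unfolding openin_mtopology by (meson subsetD)
    obtain n where n: "1 / real (Suc n) < r / 2"
      using r(1) nat_approx_posE[of "r / 2"] by auto
    have "x \<in> mtopology closure_of C" using x C by simp
    then have "\<forall>r>0. \<exists>c\<in>C. c \<in> mball x r"
      unfolding metric_closure_of by simp
    moreover have "0 < 1 / real (Suc n)" by simp
    ultimately obtain c where c: "c \<in> C" "c \<in> mball x (1 / real (Suc n))"
      by blast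
    have "mball c (1 / real (Suc n)) \<subseteq> mball x r"
    proof
      fix y assume "y \<in> mball c (1 / real (Suc n))"
      then show "y \<in> mball x r"
        using c n x triangle[of x c y] by auto
    qed
    moreover have "x \<in> mball c (1 / real (Suc n))"
      using c x by (auto simp: commute)
    moreover have "mball c (1 / real (Suc n)) \<in> B"
      unfolding B_def using c by auto
    ultimately show ?thesis using r by blast
  qed
  moreover have "countable B" unfolding B_def using C by auto
  moreover have "\<forall>V\<in>B. openin mtopology V" unfolding B_def by auto
  ultimately show ?thesis unfolding second_countable_def M by blast
qed

text \<open>Zero sets are closed under countable intersections: truncation at \<open>1\<close> and
  geometric weights make the series converge uniformly, and a sum of nonnegative terms vanishes only
  if every term does.\<close>

lemma countable_zero_set_Inter:
  fixes u :: "nat \<Rightarrow> 'a \<Rightarrow> real"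
  assumes u: "\<And>n. continuous_map T euclideanreal (u n)"
  obtains v where "continuous_map T euclideanreal v" "\<And>t. 0 \<le> v t"
    "\<And>t. v t = 0 \<longleftrightarrow> (\<forall>n. u n t = 0)"
proof -
  define w where "w n t = (1/2)^Suc n * min 1 \<bar>u n t\<bar>" for n t
  have w0: "0 \<le> w n t" and w1: "w n t \<le> (1/2)^Suc n" for n t
    unfolding w_def by (auto simp: min_def abs_mult)
  have geo: "(\<lambda>n. (1/2::real)^Suc n) sums 1" by (rule power_half_series)
  have sm: "summable (\<lambda>n. w n t)" for t
    by (rule summable_comparison_test'[OF sums_summable[OF geo], of 0]) (use w0 w1 in auto)
  define v where "v t = (\<Sum>n. w n t)" for t
  have ul: "uniform_limit (topspace T) (\<lambda>n t. \<Sum>i<n. w i t) v sequentially"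
    unfolding v_def
    by (rule Weierstrass_m_test[OF _ sums_summable[OF geo]]) (use w0 w1 in auto)
  have cw: "continuous_map T euclideanreal (w n)" for n
    unfolding w_def[abs_def] by (intro continuous_intros u)
  have "continuous_map T euclideanreal v"
    unfolding mtopology_is_euclidean[symmetric]
  proof (rule Met_TC.continuous_map_uniform_limit)
    show "\<forall>\<^sub>F n in sequentially. continuous_map T (Met_TC.mtopology) (\<lambda>t. \<Sum>i<n. w i t)"
      unfolding mtopology_is_euclidean
      by (intro always_eventually allI continuous_intros cw) auto
    show "\<forall>\<^sub>F n in sequentially. \<forall>t\<in>topspace T. v t \<in> UNIV \<and> dist (\<Sum>i<n. w i t) (v t) < e"
      if "e > 0" for e using uniform_limitD[OF ul that] by simp
  qed simp
  moreover have "0 \<le> v t" for t unfolding v_def by (intro suminf_nonneg sm w0)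
  moreover have "v t = 0 \<longleftrightarrow> (\<forall>n. u n t = 0)" for t
    unfolding v_def by (subst suminf_eq_zero_iff[OF sm w0]) (auto simp: w_def min_def)
  ultimately show ?thesis using that by blast
qed

text \<open>A regular Lindelof space is normal, hence completely regular. Each
  \<open>z \<in> W\<close> has a continuous function with value \<open>0\<close> at \<open>z\<close>
  and \<open>1\<close> off \<open>W\<close>. As \<open>W\<close> is Lindelof, countably many of the
  sets where these functions are below \<open>1\<close> cover \<open>W\<close>, and a weighted sum
  combines them.\<close>

lemma regular_Lindelof_imp_cozero:
  assumes reg: "regular_space Z" and Lin: "\<And>S. Lindelof_space (subtopology Z S)"
    and W: "openin Z W"
  obtains g :: "'a \<Rightarrow> real" where "continuous_map Z euclideanreal g" "\<And>z. 0 \<le> g z" 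
    "\<And>z. z \<in> topspace Z \<Longrightarrow> g z = 0 \<longleftrightarrow> z \<notin> W"
proof (cases "W = {}")
  case True
  then show ?thesis using that[of "\<lambda>_. 0"] by auto
next
  case False
  have WZ: "W \<subseteq> topspace Z" using W openin_subset by blast
  have "completely_regular_space Z"
    using reg Lin[of "topspace Z"] regular_Lindelof_imp_normal_space
      normal_imp_completely_regular_space by auto
  then have "\<exists>h. continuous_map Z euclideanreal h \<and> h z = 0 \<and> h ` (topspace Z - W) \<subseteq> {1}"
    if "z \<in> W" for z
    using that W WZ unfolding completely_regular_space_alt by blast
  then obtain h where h: "\<And>z. z \<in> W \<Longrightarrow> continuous_map Z euclideanreal (h z)"
    "\<And>z. z \<in> W \<Longrightarrow> h z z = 0" "\<And>z y. z \<in> W \<Longrightarrow> y \<in> topspace Z - W \<Longrightarrow> h z y = (1::real)"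
    by (metis image_subset_iff singletonD)
  define U where "U z = {y \<in> topspace Z. h z y \<in> {..<1}}" for z
  have U: "openin Z (U z)" if "z \<in> W" for z
    unfolding U_def by (rule openin_continuous_map_preimage[OF h(1)[OF that]]) auto
  have WU: "W \<subseteq> \<Union> (U ` W)"
  proof
    fix z assume "z \<in> W"
    then have "z \<in> U z" using WZ h(2)[of z] by (auto simp: U_def)
    then show "z \<in> \<Union> (U ` W)" using \<open>z \<in> W\<close> by blast
  qed
  have "\<exists>V. countable V \<and> V \<subseteq> U ` W \<and> W \<subseteq> \<Union> V"
    using Lin[of W] U WU unfolding Lindelof_space_subtopology_subset[OF WZ] by auto
  then obtain S where S: "countable S" "S \<subseteq> W" "W \<subseteq> \<Union> (U ` S)"
    by (metis countable_subset_image)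
  with False have "S \<noteq> {}" by auto
  define s where "s = from_nat_into S"
  have s: "s n \<in> S" "s n \<in> W" for n
    unfolding s_def using from_nat_into[OF \<open>S \<noteq> {}\<close>] S by auto
  have rs: "range s = S" unfolding s_def using range_from_nat_into[OF \<open>S \<noteq> {}\<close> S(1)] .
  have "continuous_map Z euclideanreal (\<lambda>y. max 0 (1 - h (s n) y))" for n
    by (intro continuous_intros h s)
  then obtain v where v: "continuous_map Z euclideanreal v" "\<And>t. 0 \<le> v t"
    "\<And>t. v t = 0 \<longleftrightarrow> (\<forall>n. max 0 (1 - h (s n) t) = 0)"
    by (rule countable_zero_set_Inter[where u="\<lambda>n y. max 0 (1 - h (s n) y)"]) blast+
  have "v z = 0 \<longleftrightarrow> z \<notin> W" if z: "z \<in> topspace Z" for z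
  proof
    assume v0: "v z = 0"
    show "z \<notin> W"
    proof
      assume "z \<in> W"
      then obtain n where "z \<in> U (s n)" using S(3) rs by auto
      then have "h (s n) z < 1" by (simp add: U_def)
      moreover have "max 0 (1 - h (s n) z) = 0" using v0 v(3) by blast
      ultimately show False by simp
    qed
  next
    assume "z \<notin> W"
    then show "v z = 0" using h(3)[OF s(2)] z v(3) by auto
  qed
  then show ?thesis using that v by blast
qed

text \<open>Each \<open>Zs n\<close> is second countable, so its part in \<open>S\<close> is
  Lindelof, and countable unions preserve this.\<close>

lemma sigma_separable_hereditarily_Lindelof:
  assumes "topspace Z = (\<Union>n. Zs n)"
    and "\<And>n::nat. metrizable_space (subtopology Z (Zs n))"
    and "\<And>n. separable_space (subtopology Z (Zs n))"
  shows "Lindelof_space (subtopology Z S)"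
proof -
  have "Lindelof_space (subtopology Z (\<Union>n. Zs n \<inter> S))"
  proof (rule Lindelof_space_Union)
    fix U assume "U \<in> range (\<lambda>n. Zs n \<inter> S)"
    then obtain n where "U = Zs n \<inter> S" by blast
    then show "Lindelof_space (subtopology Z U)"
      using second_countable_imp_Lindelof_space[OF second_countable_subtopology[OF
          separable_metrizable_imp_second_countable[OF assms(2,3)[of n]]]]
      by (simp add: subtopology_subtopology)
  qed auto
  moreover have "(\<Union>n. Zs n \<inter> S) = topspace Z \<inter> S" using assms(1) by auto
  ultimately show ?thesis by (metis subtopology_restrict)
qed

subsection \<open>Gluing along disjoint supports\<close>

text \<open>The map is pasted from \<open>P i\<close> on the set where \<open>q i\<close> is
  positive and \<open>h\<close> on the set where all \<open>q i\<close> are below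
  \<open>1/2\<close>; finiteness of \<open>S\<close> makes the latter open. By disjointness the only
  overlaps to check lie where \<open>0 < q i t < 1/2\<close>, and there \<open>P i\<close> agrees
  with \<open>h\<close>.\<close>

lemma glue_disjoint_supports:
  fixes q :: "'i \<Rightarrow> 'a \<Rightarrow> real"
  assumes S: "finite S"
    and q: "\<And>i. i \<in> S \<Longrightarrow> continuous_map T euclideanreal (q i)"
    and disj: "\<And>i j t. \<lbrakk>i \<in> S; j \<in> S; i \<noteq> j; t \<in> topspace T; 0 < q i t\<rbrakk> \<Longrightarrow> q j t \<le> 0"
    and h: "continuous_map T Z h"
    and P: "\<And>i. i \<in> S \<Longrightarrow> continuous_map T Z (P i)"
    and eq: "\<And>i t. \<lbrakk>i \<in> S; t \<in> topspace T; 0 < q i t; q i t \<le> 1/2\<rbrakk> \<Longrightarrow> P i t = h t"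
  obtains h' where "continuous_map T Z h'"
    "\<And>i t. \<lbrakk>i \<in> S; t \<in> topspace T; 0 < q i t\<rbrakk> \<Longrightarrow> h' t = P i t"
    "\<And>t. \<lbrakk>t \<in> topspace T; \<And>i. i \<in> S \<Longrightarrow> q i t \<le> 0\<rbrakk> \<Longrightarrow> h' t = h t"
proof -
  \<comment> \<open>\<open>None\<close> indexes the region that carries \<open>h\<close>, and
    \<open>Some i\<close> the support of \<open>q i\<close>.\<close>
  define W where "W = case_option (topspace T \<inter> (\<Inter>i\<in>S. {t \<in> topspace T. q i t \<in> {..<1/2}}))
    (\<lambda>i. {t \<in> topspace T. q i t \<in> {0<..}})"
  have W: "openin T (W x)" if x: "x \<in> insert None (Some ` S)" for x
  proof -
    have "openin T {t \<in> topspace T. q i t \<in> {..<1/2}}" "openin T {t \<in> topspace T. q i t \<in> {0<..}}"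
      if "i \<in> S" for i
      by (rule openin_continuous_map_preimage[OF q[OF that]]; simp)+
    then show ?thesis
      using x S unfolding W_def
      by (cases "S = {}") (auto intro!: openin_Int openin_INT2)
  qed
  define g where "g = case_option h P"
  have X: "topspace T \<subseteq> (\<Union>x\<in>insert None (Some ` S). W x)"
  proof
    fix t assume t: "t \<in> topspace T"
    show "t \<in> (\<Union>x\<in>insert None (Some ` S). W x)"
    proof (cases "\<exists>i\<in>S. 0 < q i t")
      case True
      then show ?thesis using t by (auto simp: W_def)
    next
      case False
      then have "q i t < 1/2" if "i \<in> S" for i using that by (meson half_gt_zero_iff less_le_trans not_less zero_less_one less_eq_real_def le_less_trans)
      then show ?thesis using t by (simp add: W_def)
    qed
  qed
  have C: "continuous_map (subtopology T (W x)) Z (g x)"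
    if "x \<in> insert None (Some ` S)" for x
    using that h P unfolding g_def by (auto intro: continuous_map_from_subtopology)
  have E: "g x t = g y t" if "x \<in> insert None (Some ` S)" "y \<in> insert None (Some ` S)"
    "t \<in> topspace T \<inter> W x \<inter> W y" for x y t
  proof (cases x; cases y)
    fix i j assume xy: "x = Some i" "y = Some j"
    then have "i \<in> S" "j \<in> S" "t \<in> topspace T" "0 < q i t" "0 < q j t"
      using that by (auto simp: W_def)
    then have "i = j" using disj[of i j t] by fastforce
    then show ?thesis using xy by simp
  next
    fix i assume xy: "x = Some i" "y = None"
    then have "i \<in> S" "t \<in> topspace T" "0 < q i t" "q i t \<le> 1/2"
      using that by (auto simp: W_def less_imp_le)
    then show ?thesis using eq xy by (simp add: g_def)
  next
    fix i assume xy: "x = None" "y = Some i"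
    then have "i \<in> S" "t \<in> topspace T" "0 < q i t" "q i t \<le> 1/2"
      using that by (auto simp: W_def less_imp_le)
    then show ?thesis using eq xy by (simp add: g_def)
  qed simp
  obtain h' where h': "continuous_map T Z h'"
    "\<And>t x. \<lbrakk>x \<in> insert None (Some ` S); t \<in> topspace T \<inter> W x\<rbrakk> \<Longrightarrow> h' t = g x t"
    by (rule pasting_lemma_exists[OF X W C E]) blast+
  show ?thesis
  proof (rule that[OF h'(1)])
    fix i t assume "i \<in> S" "t \<in> topspace T" "0 < q i t"
    then show "h' t = P i t" using h'(2)[of "Some i" t] by (simp add: W_def g_def)
  next
    fix t assume "t \<in> topspace T" and *: "\<And>i. i \<in> S \<Longrightarrow> q i t \<le> 0"
    have "q i t < 1/2" if "i \<in> S" for i using *[OF that] by linarith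
    then show "h' t = h t" using h'(2)[of None t] \<open>t \<in> topspace T\<close> by (simp add: W_def g_def)
  qed
qed



text \<open>
  Makes the zero sets of \<open>v 0, v 1, \<dots>\<close> disjoint: the functions \<open>collar N v l\<close> have disjoint supports and,
  for large \<open>N\<close>, value \<open>1\<close> at a point whose first vanishing function is \<open>v l\<close>.
\<close>
definition collar :: "nat \<Rightarrow> (nat \<Rightarrow> 'a \<Rightarrow> real) \<Rightarrow> nat \<Rightarrow> 'a \<Rightarrow> real" where
  "collar N v l t = max 0 (1 - 2 * real (Suc N) * v l t) *
     (\<Prod>k<l. max 0 (min 1 (2 * real (Suc N) * v k t - 1)))"

lemma collar_nonneg: "0 \<le> collar N v l t"
  unfolding collar_def by (intro mult_nonneg_nonneg prod_nonneg) auto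

lemma continuous_map_collar:
  assumes "\<And>l. continuous_map T euclideanreal (v l)"
  shows "continuous_map T euclideanreal (collar N v l)"
proof -
  have 1: "continuous_map T euclideanreal (\<lambda>t. max 0 (1 - c * v l t))" for c :: real and l
    by (intro continuous_map_real_max continuous_map_diff continuous_map_real_mult_left assms) simp_all
  have 2: "continuous_map T euclideanreal (\<lambda>t. max 0 (min 1 (c * v l t - 1)))" for c :: real and l
    by (intro continuous_map_real_max continuous_map_real_min continuous_map_diff
        continuous_map_real_mult_left assms) simp_all
  show ?thesis
    unfolding collar_def[abs_def]
    by (intro continuous_map_real_mult continuous_map_prod 1 2) simp
qed

lemma collar_eq_1:
  assumes "v l t = 0" and "\<And>k. k < l \<Longrightarrow> 1 / real (Suc N) \<le> v k t"
  shows "collar N v l t = 1"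
proof -
  have "1 \<le> 2 * real (Suc N) * v k t - 1" if "k < l" for k
    using assms(2)[OF that] by (simp add: field_simps)
  then show ?thesis using assms(1) by (simp add: collar_def min_absorb1)
qed

text \<open>Where \<open>collar N v k\<close> is positive, \<open>v k t\<close> is below
  \<open>1 / (2 * real (Suc N))\<close>, so the factor with index \<open>k\<close> in the product of
  \<open>collar N v l\<close> vanishes.\<close>

lemma collar_disjoint_less:
  assumes "k < l" "0 < collar N v k t"
  shows "collar N v l t = 0"
proof -
  have "max 0 (1 - 2 * real (Suc N) * v k t) \<noteq> 0"
    using assms(2) unfolding collar_def by (metis less_irrefl mult_zero_left)
  then have "max 0 (min 1 (2 * real (Suc N) * v k t - 1)) = 0" by (simp add: max_def min_def split: if_splits)
  then have "(\<Prod>k<l. max 0 (min 1 (2 * real (Suc N) * v k t - 1))) = 0"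
    using assms(1) by (intro prod_zero) auto
  then show ?thesis unfolding collar_def by simp
qed

lemma collar_disjoint:
  assumes "k \<noteq> l" "0 < collar N v k t"
  shows "collar N v l t = 0"
proof -
  consider "k < l" | "l < k" using assms(1) by linarith
  then show ?thesis
  proof cases
    case 1
    then show ?thesis using assms(2) by (rule collar_disjoint_less)
  next
    case 2
    then have "\<not> 0 < collar N v l t"
      using collar_disjoint_less[of l k N v t] assms(2) by (metis less_irrefl)
    then show ?thesis using collar_nonneg[of N v l t] by linarith
  qed
qed


text \<open>Only the finitely many \<open>k < l\<close> impose a lower bound on
  \<open>N\<close>.\<close>

lemma eventually_collar_eq_1:
  assumes "v l t = 0" and "\<And>k. k < l \<Longrightarrow> 0 < v k t"
  shows "\<forall>\<^sub>F N in sequentially. collar N v l t = 1"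
proof -
  have "\<forall>\<^sub>F N in sequentially. 1 / real (Suc N) \<le> v k t" if "k < l" for k
  proof -
    have "\<forall>\<^sub>F N in sequentially. 1 / real (Suc N) < v k t"
      using order_tendstoD(2)[OF LIMSEQ_inverse_real_of_nat assms(2)[OF that]]
      by (simp add: inverse_eq_divide)
    then show ?thesis by (rule eventually_mono) simp
  qed
  then have "\<forall>\<^sub>F N in sequentially. \<forall>k\<in>{..<l}. 1 / real (Suc N) \<le> v k t"
    by (intro eventually_ball_finite) auto
  then show ?thesis
    by (rule eventually_mono) (intro collar_eq_1 assms(1), simp)
qed

subsection \<open>Limits of continuous maps with values in one stratum\<close>

text \<open>A countable union of zero sets. Nonnegativity lets the sum of two functions describe the
  intersection of their zero sets.\<close>

definition zero_sigma_in :: "'a topology \<Rightarrow> 'a set \<Rightarrow> bool" where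
  "zero_sigma_in T A \<longleftrightarrow> (\<exists>u :: nat \<Rightarrow> 'a \<Rightarrow> real.
     (\<forall>n. continuous_map T euclideanreal (u n) \<and> (\<forall>t. 0 \<le> u n t)) \<and>
     A = {t \<in> topspace T. \<exists>n. u n t = 0})"

lemma zero_sigma_in_Int_zero_set:
  assumes "zero_sigma_in T A" "continuous_map T euclideanreal v" "\<And>t. 0 \<le> v t"
  shows "zero_sigma_in T {t \<in> A. v t = 0}"
proof -
  obtain u :: "nat \<Rightarrow> 'a \<Rightarrow> real" where u: "\<forall>n. continuous_map T euclideanreal (u n) \<and> (\<forall>t. 0 \<le> u n t)"
     "A = {t \<in> topspace T. \<exists>n. u n t = 0}"
    using assms(1) unfolding zero_sigma_in_def by (elim exE conjE) (rule that)
  have "{t \<in> A. v t = 0} = {t \<in> topspace T. \<exists>n. u n t + v t = 0}"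
    using u assms(3) by (auto simp: add_nonneg_eq_0_iff)
  moreover have "continuous_map T euclideanreal (\<lambda>t. u n t + v t)" for n
    using u(1) assms(2) by (intro continuous_map_add) blast+
  ultimately show ?thesis unfolding zero_sigma_in_def
    using u(1) assms(3) by (intro exI[of _ "\<lambda>n t. u n t + v t"]) auto
qed

text \<open>\<open>Q\<close> is a smallness condition, later a bound on the diameter. Local path
  connectedness gives a cover by small path connected open sets, second countability makes it
  countable, and the preimage of each member splits into countably many zero sets.\<close>

lemma countable_path_connected_cover:
  assumes M: "second_countable M" "locally_path_connected_space M"
    and f: "\<And>V. openin M V \<Longrightarrow> zero_sigma_in T {t \<in> A. f t \<in> V}"
    and fA: "f \<in> A \<rightarrow> topspace M"
    and ne: "topspace M \<noteq> {}"
    and cov: "\<And>x. x \<in> topspace M \<Longrightarrow> \<exists>V. openin M V \<and> x \<in> V \<and> Q V"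
    and Q: "\<And>V W. Q V \<Longrightarrow> W \<subseteq> V \<Longrightarrow> Q W"
  obtains G :: "nat \<Rightarrow> 'b set" and u :: "nat \<Rightarrow> 'a \<Rightarrow> real" where
    "\<And>l. path_connectedin M (G l)" "\<And>l. Q (G l)"
    "\<And>l. continuous_map T euclideanreal (u l)" "\<And>l t. 0 \<le> u l t"
    "\<And>l t. \<lbrakk>t \<in> topspace T; u l t = 0\<rbrakk> \<Longrightarrow> t \<in> A \<and> f t \<in> G l"
    "\<And>t. t \<in> A \<Longrightarrow> \<exists>l. u l t = 0"
proof -
  define \<U> where "\<U> = {U. openin M U \<and> path_connectedin M U \<and> Q U}"
  have "\<exists>U\<in>\<U>. x \<in> U" if x: "x \<in> topspace M" for x
  proof -
    obtain V where V: "openin M V" "x \<in> V" "Q V" using cov x by blast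
    then obtain U where "openin M U" "path_connectedin M U" "x \<in> U" "U \<subseteq> V"
      using M(2) unfolding locally_path_connected_space by blast
    then show ?thesis using V Q unfolding \<U>_def by blast
  qed
  then have "\<Union>\<U> = topspace M" unfolding \<U>_def using openin_subset by blast
  then obtain \<V> where \<V>: "countable \<V>" "\<V> \<subseteq> \<U>" "\<Union>\<V> = topspace M"
    using Lindelof_spaceD[OF second_countable_imp_Lindelof_space[OF M(1)], of \<U>]
    by (metis (no_types, lifting) \<U>_def mem_Collect_eq)
  have "\<V> \<noteq> {}"
  proof
    assume "\<V> = {}"
    then show False using ne \<V>(3) by (metis Union_empty)
  qed
  define H where "H = from_nat_into \<V>"
  have rH: "range H = \<V>" unfolding H_def using range_from_nat_into[OF \<open>\<V> \<noteq> {}\<close> \<V>(1)] .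
  then have H: "openin M (H k)" "path_connectedin M (H k)" "Q (H k)" for k
    using \<V>(2) unfolding \<U>_def by auto
  have "\<forall>k. \<exists>u :: nat \<Rightarrow> 'a \<Rightarrow> real. (\<forall>n. continuous_map T euclideanreal (u n) \<and> (\<forall>t. 0 \<le> u n t)) \<and>
     {t \<in> A. f t \<in> H k} = {t \<in> topspace T. \<exists>n. u n t = 0}"
    using f[OF H(1)] unfolding zero_sigma_in_def by (rule allI)
  from choice[OF this] obtain w :: "nat \<Rightarrow> nat \<Rightarrow> 'a \<Rightarrow> real" where
    "\<forall>k. (\<forall>n. continuous_map T euclideanreal (w k n) \<and> (\<forall>t. 0 \<le> w k n t)) \<and>
     {t \<in> A. f t \<in> H k} = {t \<in> topspace T. \<exists>n. w k n t = 0}" ..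
  then have w: "continuous_map T euclideanreal (w k n)" "0 \<le> w k n t"
      "{t \<in> A. f t \<in> H k} = {t \<in> topspace T. \<exists>n. w k n t = 0}" for k n t
    by simp_all
  show ?thesis
  \<comment> \<open>The index \<open>l\<close> codes a pair \<open>(k, n)\<close>: the member
    \<open>H k\<close> of the cover and the \<open>n\<close>-th zero set of its preimage.\<close>
  proof (rule that[of "\<lambda>l. H (fst (prod_decode l))"
        "\<lambda>l. w (fst (prod_decode l)) (snd (prod_decode l))"])
    fix t assume t: "t \<in> A"
    then have "f t \<in> \<Union>\<V>" using fA \<V>(3) by auto
    then obtain k where "f t \<in> H k" using rH by auto
    then have "t \<in> {t \<in> topspace T. \<exists>n. w k n t = 0}" using t w(3)[of k] by auto
    then obtain n where "w k n t = 0" by auto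
    then show "\<exists>l. w (fst (prod_decode l)) (snd (prod_decode l)) t = 0"
      by (intro exI[of _ "prod_encode (k, n)"]) simp
  next
    fix l t assume "t \<in> topspace T" "w (fst (prod_decode l)) (snd (prod_decode l)) t = 0"
    then show "t \<in> A \<and> f t \<in> H (fst (prod_decode l))"
      using w(3)[of "fst (prod_decode l)"] by blast
  qed (use H w in auto)
qed

text \<open>
  If \<open>h\<close> is constantly \<open>y l\<close> where \<open>e l > 0\<close>, it can be moved there along paths inside \<open>G l \<union> G' k\<close> to
  become constantly \<open>y' k\<close> around the part that belongs to the \<open>k\<close>-th set of the next level. The
  path is run through while \<open>q\<close> grows from \<open>1/2\<close> to \<open>3/4\<close>; the margins on both sides keep the glued map
  continuous and leave a neighbourhood for the following step.
\<close>
lemma path_refinement_step: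
  fixes e v :: "nat \<Rightarrow> 'a \<Rightarrow> real" and G G' :: "nat \<Rightarrow> 'b set"
  assumes pc: "\<And>l. path_connectedin M (G l)" "\<And>k. path_connectedin M (G' k)"
    and y: "\<And>l. G l \<noteq> {} \<Longrightarrow> y l \<in> G l" "\<And>k. G' k \<noteq> {} \<Longrightarrow> y' k \<in> G' k"
    and h: "continuous_map T M h"
    and e: "\<And>l. continuous_map T euclideanreal (e l)" "\<And>l t. 0 \<le> e l t"
      "\<And>l m t. \<lbrakk>t \<in> topspace T; l \<noteq> m; 0 < e l t\<rbrakk> \<Longrightarrow> e m t = 0"
      "\<And>l t. \<lbrakk>t \<in> topspace T; 0 < e l t\<rbrakk> \<Longrightarrow> h t = y l"
    and v: "\<And>k. continuous_map T euclideanreal (v k)"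
  shows "\<exists>h' e'. continuous_map T M h' \<and>
    (\<forall>k. continuous_map T euclideanreal (e' k)) \<and> (\<forall>k t. 0 \<le> e' k t) \<and>
    (\<forall>t\<in>topspace T. \<forall>k m. k \<noteq> m \<longrightarrow> 0 < e' k t \<longrightarrow> e' m t = 0) \<and>
    (\<forall>t\<in>topspace T. \<forall>k. 0 < e' k t \<longrightarrow> h' t = y' k) \<and>
    (\<forall>t\<in>topspace T. h' t = h t \<or>
       (\<exists>l k. G l \<inter> G' k \<noteq> {} \<and> h t \<in> G l \<and> h' t \<in> G l \<union> G' k)) \<and>
    (\<forall>t\<in>topspace T. \<forall>l\<le>N. \<forall>k\<le>N. G l \<inter> G' k \<noteq> {} \<longrightarrow> 1 \<le> e l t \<longrightarrow> collar N v k t = 1 \<longrightarrow>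
       1 \<le> e' k t)"
proof -
  \<comment> \<open>Only for sets that meet is the union path connected, which provides a path from
    \<open>y l\<close> to \<open>y' k\<close>; the bound \<open>N\<close> keeps the gluing
    finite.\<close>
  define S where "S = {(l, k). l \<le> N \<and> k \<le> N \<and> G l \<inter> G' k \<noteq> {}}"
  have finS: "finite S"
    by (rule finite_subset[of _ "{..N} \<times> {..N}"]) (auto simp: S_def)
  \<comment> \<open>Positive only in the old collar of \<open>l\<close> and the new collar of
    \<open>k\<close> at once. Two different pairs differ in a coordinate, whose collars are
    disjoint.\<close>
  define q where "q = (\<lambda>(l, k) t. e l t * collar N v k t)"
  have q0: "0 \<le> q x t" for x t
    by (cases x) (simp add: q_def e(2) collar_nonneg)
  have qc: "continuous_map T euclideanreal (q x)" for x
    by (cases x) (simp add: q_def continuous_map_real_mult e(1) continuous_map_collar[OF v])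
  have qpos: "0 < e l t \<and> 0 < collar N v k t" if "0 < q (l, k) t" for l k t
  proof -
    have "e l t \<noteq> 0" "collar N v k t \<noteq> 0" using that by (auto simp: q_def)
    then show ?thesis using e(2)[of l t] collar_nonneg[of N v k t] by linarith
  qed
  have qdisj: "q x' t \<le> 0" if "x \<noteq> x'" "t \<in> topspace T" "0 < q x t" for x x' t
  proof (cases x; cases x')
    fix l k l' k' assume x: "x = (l, k)" "x' = (l', k')"
    then have pos: "0 < e l t" "0 < collar N v k t" using qpos that(3) by auto
    have "e l' t = 0 \<or> collar N v k' t = 0"
    proof (cases "l = l'")
      case True
      then have "k \<noteq> k'" using x that(1) by simp
      then show ?thesis using collar_disjoint pos(2) by (intro disjI2)
    next
      case False
      then show ?thesis using e(3)[OF that(2) False pos(1)] by simp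
    qed
    then show ?thesis using x by (auto simp: q_def)
  qed
  have "\<exists>p. pathin M p \<and> p ` {0..1} \<subseteq> G (fst x) \<union> G' (snd x) \<and> p 0 = y (fst x) \<and> p 1 = y' (snd x)"
    if "x \<in> S" for x
  proof -
    have ne: "G (fst x) \<inter> G' (snd x) \<noteq> {}" using that by (auto simp: S_def)
    then have "path_connectedin M (G (fst x) \<union> G' (snd x))"
      by (intro path_connectedin_Un pc)
    moreover have "y (fst x) \<in> G (fst x) \<union> G' (snd x)" "y' (snd x) \<in> G (fst x) \<union> G' (snd x)"
      using y(1)[of "fst x"] y(2)[of "snd x"] ne by blast+
    ultimately have "\<exists>p. pathin M p \<and> p \<in> {0..1} \<rightarrow> G (fst x) \<union> G' (snd x) \<and>
        p 0 = y (fst x) \<and> p 1 = y' (snd x)"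
      unfolding path_connectedin by (elim conjE) (drule (1) bspec, drule (1) bspec)
    then show ?thesis by (simp only: image_subset_iff_funcset)
  qed
  from bchoice[OF ballI[OF this]] obtain p where p: "\<forall>x\<in>S. pathin M (p x) \<and>
    p x ` {0..1} \<subseteq> G (fst x) \<union> G' (snd x) \<and> p x 0 = y (fst x) \<and> p x 1 = y' (snd x)" ..
  define c where "c x t = max 0 (min 1 (4 * q x t - 2))" for x t
  have c01: "c x t \<in> {0..1}" for x t by (simp add: c_def)
  define P where "P x t = p x (c x t)" for x t
  have Pc: "continuous_map T M (P x)" if "x \<in> S" for x
  proof -
    have "continuous_map T (top_of_set {0..1}) (c x)"
      unfolding continuous_map_in_subtopology
    proof
      show "continuous_map T euclideanreal (c x)"
        unfolding c_def[abs_def]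
        by (intro continuous_map_real_max continuous_map_real_min continuous_map_diff
            continuous_map_real_mult_left qc) simp_all
    qed (use c01 in blast)
    moreover have "continuous_map (top_of_set {0..1}) M (p x)"
      using p that by (simp add: pathin_def)
    ultimately show ?thesis
      unfolding P_def[abs_def] using continuous_map_compose[of T _ "c x" M "p x"] by (simp add: o_def)
  qed
  have Peq: "P x t = h t" if "x \<in> S" "t \<in> topspace T" "0 < q x t" "q x t \<le> 1/2" for x t
  proof -
    have "c x t = 0" using that(4) by (simp add: c_def)
    then have "P x t = y (fst x)" using p that(1) by (simp add: P_def)
    moreover have "0 < e (fst x) t" using qpos[of "fst x" "snd x" t] that(3) by simp
    ultimately show ?thesis using e(4)[OF that(2)] by simp
  qed
  obtain h' where h': "continuous_map T M h'"
    "\<And>x t. \<lbrakk>x \<in> S; t \<in> topspace T; 0 < q x t\<rbrakk> \<Longrightarrow> h' t = P x t"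
    "\<And>t. \<lbrakk>t \<in> topspace T; \<And>x. x \<in> S \<Longrightarrow> q x t \<le> 0\<rbrakk> \<Longrightarrow> h' t = h t"
    by (rule glue_disjoint_supports[where S=S and q=q and T=T and h=h and P=P and Z=M])
      (use finS qc qdisj h Pc Peq in auto)
  \<comment> \<open>A summand is positive only where \<open>q\<close> exceeds \<open>3/4\<close>, so
    that the path has already arrived at \<open>y' k\<close>, and it is \<open>1\<close> where
    \<open>q\<close> is \<open>1\<close>. Summing over \<open>l\<close> forgets the origin of the
    path; by disjointness at most one summand is nonzero.\<close>
  define e' where "e' k t = (\<Sum>l | (l, k) \<in> S. max 0 (4 * q (l, k) t - 3))" for k t
  have fin: "finite {l. (l, k) \<in> S}" for k
    by (rule finite_subset[of _ "{..N}"]) (auto simp: S_def)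
  have e'pos: "\<exists>l. (l, k) \<in> S \<and> 3/4 < q (l, k) t" if "0 < e' k t" for k t
  proof (rule ccontr)
    assume *: "\<not> ?thesis"
    have "max 0 (4 * q (l, k) t - 3) = 0" if "(l, k) \<in> S" for l
      using * that by force
    then have "e' k t = 0" unfolding e'_def by (intro sum.neutral) simp
    then show False using that by simp
  qed
  have "continuous_map T euclideanreal (e' k)" for k
    unfolding e'_def[abs_def]
    by (intro continuous_map_sum fin continuous_map_real_max continuous_map_diff
        continuous_map_real_mult_left qc) simp_all
  moreover have "0 \<le> e' k t" for k t unfolding e'_def by (intro sum_nonneg) simp
  moreover have "e' m t = 0" if t: "t \<in> topspace T" "k \<noteq> m" "0 < e' k t" for k m t
  proof -
    obtain l where l: "3/4 < q (l, k) t" using e'pos t(3) by blast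
    have "max 0 (4 * q (l', m) t - 3) = 0" for l'
      using qdisj[of "(l, k)" "(l', m)" t] l t by simp
    then show ?thesis unfolding e'_def by (intro sum.neutral) simp
  qed
  moreover have "h' t = y' k" if t: "t \<in> topspace T" "0 < e' k t" for k t
  proof -
    obtain l where l: "(l, k) \<in> S" "3/4 < q (l, k) t" using e'pos t(2) by blast
    then have "h' t = P (l, k) t" using h'(2) t(1) by simp
    moreover have "c (l, k) t = 1" using l(2) by (simp add: c_def)
    ultimately show ?thesis using p l(1) by (simp add: P_def)
  qed
  moreover have "h' t = h t \<or> (\<exists>l k. G l \<inter> G' k \<noteq> {} \<and> h t \<in> G l \<and> h' t \<in> G l \<union> G' k)"
    if t: "t \<in> topspace T" for t
  proof (cases "\<exists>x\<in>S. 0 < q x t")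
    case True
    then obtain l k where x: "(l, k) \<in> S" "0 < q (l, k) t" by auto
    have ne: "G l \<inter> G' k \<noteq> {}" using x(1) by (simp add: S_def)
    have "h' t = p (l, k) (c (l, k) t)" using h'(2)[OF x(1) t x(2)] by (simp add: P_def)
    then have "h' t \<in> G l \<union> G' k" using p x(1) c01[of "(l, k)" t] by force
    moreover have "h t = y l" using e(4)[OF t] qpos[OF x(2)] by blast
    moreover have "y l \<in> G l" using y(1)[of l] ne by blast
    ultimately show ?thesis using ne by auto
  next
    case False
    then have "h' t = h t" by (intro h'(3) t) (simp add: not_less)
    then show ?thesis ..
  qed
  moreover have "1 \<le> e' k t" if "t \<in> topspace T" "l \<le> N" "k \<le> N" "G l \<inter> G' k \<noteq> {}" "1 \<le> e l t"
    "collar N v k t = 1" for l k t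
  proof -
    have lk: "l \<in> {l. (l, k) \<in> S}" using that by (simp add: S_def)
    have "1 \<le> max 0 (4 * q (l, k) t - 3)" using that by (simp add: q_def)
    also have "\<dots> \<le> e' k t" unfolding e'_def by (rule member_le_sum[OF lk]) (use fin in auto)
    finally show ?thesis .
  qed
  ultimately show ?thesis using h'(1) by (intro exI[of _ h'] exI[of _ e']) blast
qed

text \<open>For fixed \<open>N\<close>, maps \<open>h N n\<close> are refined level by level,
  starting from a constant map. For \<open>t \<in> A\<close>, \<open>n > 0\<close> and all large
  \<open>N\<close>, the point \<open>h N n t\<close> lies in a small set of level \<open>n\<close>
  that also contains \<open>f t\<close>, and the later refinements move it by at most
  \<open>4 * (1/2)^n\<close>. Hence the diagonal maps \<open>h N N\<close> converge to
  \<open>f\<close> on \<open>A\<close>.\<close>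

lemma zero_sigma_preimages_imp_limit:
  assumes M: "metrizable_space M" "second_countable M" "path_connected_space M"
      "locally_path_connected_space M" "topspace M \<noteq> {}"
    and fA: "f \<in> A \<rightarrow> topspace M"
    and f: "\<And>V. openin M V \<Longrightarrow> zero_sigma_in T {t \<in> A. f t \<in> V}"
  shows "\<exists>H :: nat \<Rightarrow> 'a \<Rightarrow> 'b. (\<forall>N. continuous_map T M (H N)) \<and>
    (\<forall>t\<in>A. limitin M (\<lambda>N. H N t) (f t) sequentially)"
proof -
  obtain B d where "Metric_space B d" and MB: "M = Metric_space.mtopology B d"
    using M(1) by (auto simp: metrizable_space_def)
  interpret Metric_space B d by fact
  have top: "topspace M = B" by (simp add: MB)
  have fA': "{t \<in> A. f t \<in> topspace M} = A" using fA by auto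
  have zA: "zero_sigma_in T A" using f[OF openin_topspace] unfolding fA' .
  then have AT: "A \<subseteq> topspace T" by (auto simp: zero_sigma_in_def)
  \<comment> \<open>Level \<open>0\<close> has no diameter bound: its only set is the whole space
    \<open>B\<close>, so that a constant map can start the refinement.\<close>
  define Q where "Q n V \<longleftrightarrow> V \<subseteq> B \<and> (n = 0 \<or> (\<forall>x\<in>V. \<forall>y\<in>V. d x y \<le> (1/2)^n))" for n :: nat and V
  define R where "R n Gu \<longleftrightarrow>
      (\<forall>l. path_connectedin M (fst Gu l)) \<and> (\<forall>l. Q n (fst Gu l)) \<and>
      (n = 0 \<longrightarrow> (\<forall>l. fst Gu l = B)) \<and>
      (\<forall>l. continuous_map T euclideanreal (snd Gu l)) \<and> (\<forall>l t. 0 \<le> snd Gu l t) \<and>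
      (\<forall>l. \<forall>t\<in>topspace T. snd Gu l t = 0 \<longrightarrow> t \<in> A \<and> f t \<in> fst Gu l) \<and>
      (\<forall>t\<in>A. \<exists>l. snd Gu l t = 0)"
    for n and Gu :: "(nat \<Rightarrow> 'b set) \<times> (nat \<Rightarrow> 'a \<Rightarrow> real)"
  have "\<forall>n. \<exists>Gu. R n Gu"
  proof
    fix n
    show "\<exists>Gu. R n Gu"
    proof (cases "n = 0")
      case True
      obtain u :: "nat \<Rightarrow> 'a \<Rightarrow> real" where
        u: "\<And>l. continuous_map T euclideanreal (u l)" "\<And>l t. 0 \<le> u l t"
        "A = {t \<in> topspace T. \<exists>l. u l t = 0}"
        using zA unfolding zero_sigma_in_def by (elim exE conjE) (rule that, blast, blast, assumption)
      have "R n (\<lambda>_. B, u)"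
        unfolding R_def fst_conv snd_conv
      proof (intro conjI allI ballI impI)
        show "path_connectedin M B" using M(3) top by (metis path_connectedin_topspace)
        show "Q n B" using True by (simp add: Q_def)
        show "t \<in> A" if "t \<in> topspace T" "u l t = 0" for l t using that u(3) by blast
        show "f t \<in> B" if "t \<in> topspace T" "u l t = 0" for l t
          using that u(3) fA top by blast
        show "\<exists>l. u l t = 0" if "t \<in> A" for t using that u(3) by blast
      qed (use u in auto)
      then show ?thesis ..
    next
      case False
      have cov: "\<exists>V. openin M V \<and> x \<in> V \<and> Q n V" if "x \<in> topspace M" for x
      proof (intro exI conjI)
        show "openin M (mball x ((1/2)^n / 2))" by (simp add: MB)
        show "x \<in> mball x ((1/2)^n / 2)" using that by (simp add: top)
        show "Q n (mball x ((1/2)^n / 2))"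
          unfolding Q_def
        proof (intro conjI disjI2 ballI)
          fix a b assume "a \<in> mball x ((1/2)^n / 2)" "b \<in> mball x ((1/2)^n / 2)"
          then show "d a b \<le> (1/2)^n"
            using triangle[of a x b] by (simp add: commute[of a x])
        qed auto
      qed
      have QQ: "Q n W" if "Q n V" "W \<subseteq> V" for V W
        using that unfolding Q_def by blast
      show ?thesis
      proof (rule countable_path_connected_cover[where Q="Q n" and M=M and T=T and f=f and A=A])
        fix G u assume "\<And>l. path_connectedin M (G l)" "\<And>l. Q n (G l)"
          "\<And>l::nat. continuous_map T euclideanreal (u l)" "\<And>l t. 0 \<le> u l t"
          "\<And>l t. \<lbrakk>t \<in> topspace T; u l t = 0\<rbrakk> \<Longrightarrow> t \<in> A \<and> f t \<in> G l"
          "\<And>t. t \<in> A \<Longrightarrow> \<exists>l. u l t = 0"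
        then have "R n (G, u)" using False by (simp add: R_def)
        then show ?thesis ..
      qed (fact M(2) M(4) f fA M(5) cov | erule (1) QQ)+
    qed
  qed
  from choice[OF this] obtain Gu where Gu: "\<forall>n. R n (Gu n)" ..
  define G where "G n = fst (Gu n)" for n
  define v where "v n = snd (Gu n)" for n
  have RG: "R n (G n, v n)" for n using Gu by (simp add: G_def v_def)
  note R = RG[unfolded R_def fst_conv snd_conv]
  have G: "path_connectedin M (G n l)" "Q n (G n l)" "G 0 l = B"
    and v: "continuous_map T euclideanreal (v n l)" "0 \<le> v n l t" for n l t
    using R[of n] R[of 0] by simp_all
  have vG: "f t \<in> G n l" if "t \<in> topspace T" "v n l t = 0" for n l t
    using R[of n] that by simp
  have vA: "\<exists>l. v n l t = 0" if "t \<in> A" for n t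
    using R[of n] that by simp
  define y where "y n l = (SOME z. z \<in> G n l)" for n l
  have y: "y n l \<in> G n l" if "G n l \<noteq> {}" for n l
    using that unfolding y_def by (simp add: some_in_eq)
  \<comment> \<open>All \<open>G 0 l\<close> are the same set, so \<open>SOME\<close> picks the same
    point; a single constant map then has the required value on every initial collar.\<close>
  have y0: "y 0 l = y 0 0" for l unfolding y_def G(3) ..
  \<comment> \<open>The invariant after \<open>n\<close> refinements: \<open>fst he\<close> is the
    map, \<open>snd he\<close> its collars. The last clause fixes the initial collars, from which
    the later ones are traced by induction.\<close>
  define P where "P N n he \<longleftrightarrow> continuous_map T M (fst he) \<and>
      (\<forall>l. continuous_map T euclideanreal (snd he l)) \<and> (\<forall>l t. 0 \<le> snd he l t) \<and>
      (\<forall>t\<in>topspace T. \<forall>k m. k \<noteq> m \<longrightarrow> 0 < snd he k t \<longrightarrow> snd he m t = 0) \<and>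
      (\<forall>t\<in>topspace T. \<forall>k. 0 < snd he k t \<longrightarrow> fst he t = y n k) \<and>
      (n = 0 \<longrightarrow> snd he = collar N (v 0))"
    for N n and he :: "('a \<Rightarrow> 'b) \<times> (nat \<Rightarrow> 'a \<Rightarrow> real)"
  define S where "S N n he he' \<longleftrightarrow>
     (\<forall>t\<in>topspace T. fst he' t = fst he t \<or>
       (\<exists>l k. G n l \<inter> G (Suc n) k \<noteq> {} \<and> fst he t \<in> G n l \<and> fst he' t \<in> G n l \<union> G (Suc n) k)) \<and>
     (\<forall>t\<in>topspace T. \<forall>l\<le>N. \<forall>k\<le>N. G n l \<inter> G (Suc n) k \<noteq> {} \<longrightarrow> 1 \<le> snd he l t \<longrightarrow>
       collar N (v (Suc n)) k t = 1 \<longrightarrow> 1 \<le> snd he' k t)"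
    for N n and he he' :: "('a \<Rightarrow> 'b) \<times> (nat \<Rightarrow> 'a \<Rightarrow> real)"
  have "\<forall>N. \<exists>s. \<forall>n. P N n (s n) \<and> S N n (s n) (s (Suc n))"
  proof
    fix N
    show "\<exists>s. \<forall>n. P N n (s n) \<and> S N n (s n) (s (Suc n))"
    proof (rule dependent_nat_choice)
      have "y 0 0 \<in> topspace M" using y[of 0 0] G(3) M(5) top by simp
      then have "P N 0 (\<lambda>_. y 0 0, collar N (v 0))"
        unfolding P_def using continuous_map_collar[of T "v 0" N] v(1)
        by (auto simp: collar_nonneg collar_disjoint intro: y0[symmetric])
      then show "\<exists>he. P N 0 he" ..
    next
      fix he n assume P: "P N n he"
      have "\<exists>h' e'. continuous_map T M h' \<and>
        (\<forall>k. continuous_map T euclideanreal (e' k)) \<and> (\<forall>k t. 0 \<le> e' k t) \<and>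
        (\<forall>t\<in>topspace T. \<forall>k m. k \<noteq> m \<longrightarrow> 0 < e' k t \<longrightarrow> e' m t = 0) \<and>
        (\<forall>t\<in>topspace T. \<forall>k. 0 < e' k t \<longrightarrow> h' t = y (Suc n) k) \<and>
        (\<forall>t\<in>topspace T. h' t = fst he t \<or>
           (\<exists>l k. G n l \<inter> G (Suc n) k \<noteq> {} \<and> fst he t \<in> G n l \<and> h' t \<in> G n l \<union> G (Suc n) k)) \<and>
        (\<forall>t\<in>topspace T. \<forall>l\<le>N. \<forall>k\<le>N. G n l \<inter> G (Suc n) k \<noteq> {} \<longrightarrow> 1 \<le> snd he l t \<longrightarrow>
           collar N (v (Suc n)) k t = 1 \<longrightarrow> 1 \<le> e' k t)"
        by (rule path_refinement_step[where y="y n"]) (use P G(1) y v(1) in \<open>simp_all add: P_def\<close>)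
      then obtain h' e' where "P N (Suc n) (h', e') \<and> S N n he (h', e')"
        unfolding P_def S_def fst_conv snd_conv by (elim exE) simp
      then show "\<exists>he'. P N (Suc n) he' \<and> S N n he he'" ..
    qed
  qed
  from choice[OF this] obtain s where s: "\<forall>N n. P N n (s N n) \<and> S N n (s N n) (s N (Suc n))" ..
  define h where "h N n = fst (s N n)" for N n
  define e where "e N n = snd (s N n)" for N n
  have PS: "P N n (h N n, e N n)" "S N n (h N n, e N n) (h N (Suc n), e N (Suc n))" for N n
    using s by (simp_all add: h_def e_def)
  note P = PS(1)[unfolded P_def fst_conv snd_conv] and S = PS(2)[unfolded S_def fst_conv snd_conv]
  have hc: "continuous_map T M (h N n)" and e0: "e N 0 = collar N (v 0)" for N n
    using P[of N n] P[of N 0] by simp_all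
  have hy: "h N n t = y n l" if "t \<in> topspace T" "0 < e N n l t" for N n t l
    using P[of N n] that by simp
  have hstep: "h N (Suc n) t = h N n t \<or>
       (\<exists>l k. G n l \<inter> G (Suc n) k \<noteq> {} \<and> h N n t \<in> G n l \<and> h N (Suc n) t \<in> G n l \<union> G (Suc n) k)"
    if "t \<in> topspace T" for N n t
    using bspec[OF conjunct1[OF S] that] .
  have estep: "1 \<le> e N (Suc n) k t"
    if "t \<in> topspace T" "l \<le> N" "k \<le> N" "G n l \<inter> G (Suc n) k \<noteq> {}"
       "1 \<le> e N n l t" "collar N (v (Suc n)) k t = 1" for N n t l k
    using bspec[OF conjunct2[OF S] that(1)] that(2-) by simp
  have hB: "h N n t \<in> B" if "t \<in> topspace T" for N n t
    using continuous_map_image_subset_topspace[OF hc] that top by blast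
  have dG: "d a b \<le> (1/2)^n" if "a \<in> G n l" "b \<in> G n l" "0 < n" for a b n l
    using G(2)[of n l] that unfolding Q_def by simp
  have GB: "G n l \<subseteq> B" for n l using G(2)[of n l] unfolding Q_def by simp
  \<comment> \<open>The detour through a common point of the two sets costs at most one diameter for
    each; level \<open>0\<close> is excluded for want of a bound.\<close>
  have dstep: "d (h N n t) (h N (Suc n) t) \<le> 2 * (1/2)^n" if t: "t \<in> topspace T" and n: "0 < n" for N n t
    using hstep[OF t, of N n]
  proof (elim disjE exE conjE)
    assume "h N (Suc n) t = h N n t"
    then show ?thesis using hB[OF t] by simp
  next
    fix l k assume *: "G n l \<inter> G (Suc n) k \<noteq> {}" "h N n t \<in> G n l" "h N (Suc n) t \<in> G n l \<union> G (Suc n) k"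
    then obtain w where w: "w \<in> G n l" "w \<in> G (Suc n) k" by blast
    have "d (h N n t) w \<le> (1/2)^n" using dG[OF *(2) w(1) n] .
    moreover have "d w (h N (Suc n) t) \<le> (1/2)^n" using *(3)
    proof
      assume "h N (Suc n) t \<in> G n l"
      then show ?thesis using dG[OF w(1) _ n] by blast
    next
      assume "h N (Suc n) t \<in> G (Suc n) k"
      then have "d w (h N (Suc n) t) \<le> (1/2)^Suc n" using dG[OF w(2)] by blast
      also have "\<dots> \<le> (1/2)^n" by simp
      finally show ?thesis .
    qed
    ultimately show ?thesis
      using triangle[of "h N n t" w "h N (Suc n) t"] hB[OF t] GB w(1) by (smt (verit) subsetD)
  qed
  \<comment> \<open>The steps \<open>2 * (1/2)^i\<close> are summed as a geometric series;
    subtracting its remaining tail makes the induction go through.\<close>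
  have dsum: "d (h N n t) (h N (n + j) t) \<le> 4 * (1/2)^n - 4 * (1/2)^(n + j)"
    if t: "t \<in> topspace T" and n: "0 < n" for N n j t
  proof (induction j)
    case 0
    then show ?case using hB[OF t] by simp
  next
    case (Suc j)
    have "d (h N (n + j) t) (h N (Suc (n + j)) t) \<le> 2 * (1/2)^(n + j)"
      by (rule dstep[OF t]) (use n in simp)
    moreover have "(4::real) * (1/2)^Suc (n + j) = 2 * (1/2)^(n + j)" by simp
    ultimately show ?case
      using Suc triangle[of "h N n t" "h N (n + j) t" "h N (Suc (n + j)) t", OF hB[OF t] hB[OF t] hB[OF t]]
      unfolding add_Suc_right by linarith
  qed
  have "limitin M (\<lambda>N. h N N t) (f t) sequentially" if tA: "t \<in> A" for t
  proof -
    have t: "t \<in> topspace T" using tA AT by blast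
    have ft: "f t \<in> B" using fA tA top by blast
    \<comment> \<open>The first vanishing index at each level is the one whose collar eventually has
      value \<open>1\<close> at \<open>t\<close>.\<close>
    define c where "c i = (LEAST l. v i l t = 0)" for i
    have c: "v i (c i) t = 0" for i unfolding c_def by (rule LeastI_ex) (rule vA[OF tA])
    have cl: "0 < v i k t" if "k < c i" for i k
      using not_less_Least[OF that[unfolded c_def]] v(2)[of i k t] by linarith
    have fG: "f t \<in> G i (c i)" for i using vG[OF t c] .
    have evc: "\<forall>\<^sub>F N in sequentially. collar N (v i) (c i) t = 1 \<and> c i \<le> N" for i
      using eventually_collar_eq_1[of "v i", OF c cl] eventually_ge_at_top[of "c i"]
      by (rule eventually_conj)
    \<comment> \<open>The constant is \<open>4\<close> for the movement after level \<open>n\<close>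
      plus \<open>1\<close> for the diameter of \<open>G n (c n)\<close>.\<close>
    have close: "\<forall>\<^sub>F N in sequentially. d (h N N t) (f t) \<le> 5 * (1/2)^n" if n: "0 < n" for n
    proof -
      \<comment> \<open>Only the finitely many levels up to \<open>n\<close> are controlled, so one
        threshold for \<open>N\<close> serves them all.\<close>
      have "\<forall>\<^sub>F N in sequentially. \<forall>i\<in>{..n}. collar N (v i) (c i) t = 1 \<and> c i \<le> N"
        by (intro eventually_ball_finite ballI evc) simp
      then show ?thesis using eventually_ge_at_top[of n]
      proof eventually_elim
        case (elim N)
        \<comment> \<open>Consecutive sets \<open>G i (c i)\<close> both contain \<open>f t\<close>,
          so they meet, and since \<open>c i \<le> N\<close> the pair takes part in the
          refinement.\<close>
        have "i \<le> n \<Longrightarrow> 1 \<le> e N i (c i) t" for i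
        proof (induction i)
          case 0
          then show ?case using elim(1) e0 by simp
        next
          case (Suc i)
          have i: "i \<in> {..n}" "Suc i \<in> {..n}" using Suc.prems by simp_all
          have "G i (c i) \<inter> G (Suc i) (c (Suc i)) \<noteq> {}" using fG by blast
          then show ?case
            using estep[OF t, of "c i" N "c (Suc i)" i] Suc elim(1)[rule_format, OF i(1)]
              elim(1)[rule_format, OF i(2)] by simp
        qed
        then have "0 < e N n (c n) t" by (meson less_le_trans order_refl zero_less_one)
        then have "h N n t = y n (c n)" using hy[OF t] by blast
        then have "h N n t \<in> G n (c n)" using y fG by (metis empty_iff)
        then have "d (h N n t) (f t) \<le> (1/2)^n" using dG fG n by blast
        moreover have "d (h N n t) (h N N t) \<le> 4 * (1/2)^n - 4 * (1/2)^N"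
          using dsum[OF t n, of N "N - n"] elim(2) by simp
        moreover have "0 \<le> (1/2::real)^N" by simp
        ultimately show ?case
          using triangle[of "h N N t" "h N n t" "f t", OF hB[OF t] hB[OF t] ft] commute[of "h N N t" "h N n t"]
          by linarith
      qed
    qed
    show ?thesis unfolding MB limitin_metric
    proof (intro conjI allI impI)
      fix \<epsilon> :: real assume "0 < \<epsilon>"
      \<comment> \<open>The estimate is applied at \<open>Suc n\<close>, because
        \<open>close\<close> requires a positive level.\<close>
      then obtain n where n: "(1/2)^n < \<epsilon> / 5"
        using real_arch_pow_inv[of "\<epsilon> / 5" "1/2"] by auto
      have "(1/2::real)^Suc n \<le> (1/2)^n" by simp
      with n have n': "5 * (1/2)^Suc n < \<epsilon>" by linarith
      show "\<forall>\<^sub>F N in sequentially. h N N t \<in> B \<and> d (h N N t) (f t) < \<epsilon>"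
        using close[of "Suc n", OF zero_less_Suc]
        by (rule eventually_mono) (use n' hB[OF t] in auto)
    qed (rule ft)
  qed
  then show ?thesis using hc by (intro exI[of _ "\<lambda>N. h N N"]) blast
qed

subsection \<open>Sampling along a strong PP system\<close>

text \<open>Let \<open>\<phi> i\<close> be a function with co-zero set \<open>U i\<close>. The sum
  of \<open>\<phi> i x * w i y\<close> is locally finite in \<open>x\<close>, hence continuous, and
  its terms are nonnegative, so it vanishes exactly when \<open>w i y = 0\<close> for all
  \<open>i\<close> with \<open>x \<in> U i\<close>.\<close>

lemma locally_finite_zero_set:
  fixes U :: "'i \<Rightarrow> 'a set" and w :: "'i \<Rightarrow> 'b \<Rightarrow> real"
  assumes lf: "locally_finite_family X I U"
    and coz: "\<And>i. i \<in> I \<Longrightarrow> cozero_in X (U i)"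
    and w: "\<And>i. i \<in> I \<Longrightarrow> continuous_map Y euclideanreal (w i)" "\<And>i y. 0 \<le> w i y"
  shows "\<exists>s. continuous_map (prod_topology X Y) euclideanreal s \<and> (\<forall>t. 0 \<le> s t) \<and>
    (\<forall>x\<in>topspace X. \<forall>y. s (x, y) = 0 \<longleftrightarrow> (\<forall>i\<in>I. x \<in> U i \<longrightarrow> w i y = 0))"
proof -
  have "\<forall>i\<in>I. \<exists>g :: 'a \<Rightarrow> real. continuous_map X euclideanreal g \<and>
      (\<forall>x\<in>topspace X. 0 \<le> g x \<and> (x \<in> U i \<longleftrightarrow> 0 < g x))"
  proof
    fix i assume "i \<in> I"
    then obtain g :: "'a \<Rightarrow> real" where g: "continuous_map X (top_of_set {0..1}) g"
      "U i = {x \<in> topspace X. g x \<in> {0<..1}}"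
      using coz unfolding cozero_in_def by blast
    have gc: "continuous_map X euclideanreal g" and "g \<in> topspace X \<rightarrow> {0..1}"
      using g(1) unfolding continuous_map_in_subtopology by auto
    then have "0 \<le> g x \<and> g x \<le> 1" if "x \<in> topspace X" for x using that by auto
    then show "\<exists>g :: 'a \<Rightarrow> real. continuous_map X euclideanreal g \<and>
      (\<forall>x\<in>topspace X. 0 \<le> g x \<and> (x \<in> U i \<longleftrightarrow> 0 < g x))"
      using gc g(2) by (intro exI[of _ g]) simp
  qed
  from bchoice[OF this] obtain \<phi> :: "'i \<Rightarrow> 'a \<Rightarrow> real" where
    "\<forall>i\<in>I. continuous_map X euclideanreal (\<phi> i) \<and>
      (\<forall>x\<in>topspace X. 0 \<le> \<phi> i x \<and> (x \<in> U i \<longleftrightarrow> 0 < \<phi> i x))" ..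
  then have \<phi>: "\<And>i. i \<in> I \<Longrightarrow> continuous_map X euclideanreal (\<phi> i)"
    "\<And>i x. \<lbrakk>i \<in> I; x \<in> topspace X\<rbrakk> \<Longrightarrow> 0 \<le> \<phi> i x"
    "\<And>i x. \<lbrakk>i \<in> I; x \<in> topspace X\<rbrakk> \<Longrightarrow> x \<in> U i \<longleftrightarrow> 0 < \<phi> i x"
    by simp_all
  have UX: "U i \<subseteq> topspace X" if "i \<in> I" for i
    using lf that unfolding locally_finite_family_def by simp
  have "\<forall>x\<in>topspace X. \<exists>V. openin X V \<and> x \<in> V \<and> finite {i \<in> I. U i \<inter> V \<noteq> {}}"
    using lf unfolding locally_finite_family_def by simp
  from bchoice[OF this] obtain V where
    V: "\<forall>x\<in>topspace X. openin X (V x) \<and> x \<in> V x \<and> finite {i \<in> I. U i \<inter> V x \<noteq> {}}" ..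
  \<comment> \<open>Only indices with \<open>x \<in> U i\<close> occur, so each sum is finite; over
    \<open>V a\<close> it equals the sum \<open>r a\<close> over the fixed finite set
    \<open>J a\<close>, which gives continuity by pasting.\<close>
  define s where "s = (\<lambda>(x, y). \<Sum>i | i \<in> I \<and> x \<in> U i. \<phi> i x * w i y)"
  define J where "J x = {i \<in> I. U i \<inter> V x \<noteq> {}}" for x
  define r where "r a t = (\<Sum>i\<in>J a. \<phi> i (fst t) * w i (snd t))" for a t
  have finJ: "finite (J a)" if "a \<in> topspace X" for a using V that unfolding J_def by simp
  have sr: "s (x, y) = r a (x, y)" if "a \<in> topspace X" "x \<in> topspace X" "x \<in> V a" for a x y
  proof -
    have "(\<Sum>i | i \<in> I \<and> x \<in> U i. \<phi> i x * w i y) = (\<Sum>i\<in>J a. \<phi> i x * w i y)"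
    proof (rule sum.mono_neutral_left[OF finJ[OF that(1)]])
      show "{i. i \<in> I \<and> x \<in> U i} \<subseteq> J a" using that(3) by (auto simp: J_def)
      show "\<forall>i\<in>J a - {i. i \<in> I \<and> x \<in> U i}. \<phi> i x * w i y = 0"
      proof
        fix i assume "i \<in> J a - {i. i \<in> I \<and> x \<in> U i}"
        then have "i \<in> I" "x \<notin> U i" by (auto simp: J_def)
        then have "\<phi> i x = 0" using \<phi>(2,3)[of i x] that(2) by auto
        then show "\<phi> i x * w i y = 0" by simp
      qed
    qed
    then show ?thesis by (simp add: s_def r_def)
  qed
  have "continuous_map (prod_topology X Y) euclideanreal s"
  proof (rule pasting_lemma[where I="topspace X" and T="\<lambda>a. V a \<times> topspace Y" and f=r])
    fix a assume a: "a \<in> topspace X"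
    show "openin (prod_topology X Y) (V a \<times> topspace Y)"
      using V a by (simp add: openin_prod_Times_iff)
    have "continuous_map (prod_topology X Y) euclideanreal (r a)"
      unfolding r_def[abs_def]
    proof (intro continuous_map_sum continuous_map_real_mult finJ[OF a])
      fix i assume "i \<in> J a"
      then have i: "i \<in> I" by (simp add: J_def)
      show "continuous_map (prod_topology X Y) euclideanreal (\<lambda>t. \<phi> i (fst t))"
        using continuous_map_compose[OF continuous_map_fst \<phi>(1)[OF i]] by (simp add: o_def)
      show "continuous_map (prod_topology X Y) euclideanreal (\<lambda>t. w i (snd t))"
        using continuous_map_compose[OF continuous_map_snd w(1)[OF i]] by (simp add: o_def)
    qed
    then show "continuous_map (subtopology (prod_topology X Y) (V a \<times> topspace Y)) euclideanreal (r a)"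
      by (rule continuous_map_from_subtopology)
  next
    fix a b t assume "a \<in> topspace X" "b \<in> topspace X"
      "t \<in> topspace (prod_topology X Y) \<inter> (V a \<times> topspace Y) \<inter> (V b \<times> topspace Y)"
    then show "r a t = r b t"
      using sr[of a "fst t" "snd t"] sr[of b "fst t" "snd t"] by (auto simp: mem_Times_iff)
  next
    fix t assume "t \<in> topspace (prod_topology X Y)"
    then have t: "fst t \<in> topspace X" "snd t \<in> topspace Y" by auto
    have "fst t \<in> V (fst t)" using V t(1) by blast
    then show "\<exists>j. j \<in> topspace X \<and> t \<in> V j \<times> topspace Y \<and> s t = r j t"
      using sr[OF t(1) t(1), of "snd t"] t by (intro exI[of _ "fst t"]) (simp add: mem_Times_iff)
  qed
  moreover have "0 \<le> s t" for t
    unfolding s_def split_beta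
    by (intro sum_nonneg mult_nonneg_nonneg w(2)) (use \<phi>(2) UX in blast)
  moreover have "s (x, y) = 0 \<longleftrightarrow> (\<forall>i\<in>I. x \<in> U i \<longrightarrow> w i y = 0)" if x: "x \<in> topspace X" for x y
  proof -
    have fin: "finite {i. i \<in> I \<and> x \<in> U i}"
      by (rule finite_subset[OF _ finJ[OF x]]) (use V x in \<open>auto simp: J_def\<close>)
    have "s (x, y) = 0 \<longleftrightarrow> (\<forall>i\<in>{i. i \<in> I \<and> x \<in> U i}. \<phi> i x * w i y = 0)"
      unfolding s_def split_conv
      by (rule sum_nonneg_eq_0_iff[OF fin]) (use \<phi>(2) x w(2) in simp)
    also have "\<dots> \<longleftrightarrow> (\<forall>i\<in>I. x \<in> U i \<longrightarrow> w i y = 0)"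
      using \<phi>(3) x by fastforce
    finally show ?thesis .
  qed
  ultimately show ?thesis by (intro exI[of _ s]) blast
qed

locale strong_PP_sampling =
  fixes X :: "'a topology" and Y :: "'b topology" and Z :: "'c topology" and D :: "'a set"
    and I :: "nat \<Rightarrow> 'i set" and U :: "nat \<Rightarrow> 'i \<Rightarrow> 'a set" and p :: "nat \<Rightarrow> 'i \<Rightarrow> 'a"
    and f :: "'a \<times> 'b \<Rightarrow> 'c"
  assumes sys: "strong_PP_system X D I U p"
    and f1: "\<And>y. y \<in> topspace Y \<Longrightarrow> continuous_map X Z (\<lambda>x. f (x, y))"
    and f2: "\<And>x. x \<in> D \<Longrightarrow> continuous_map Y Z (\<lambda>y. f (x, y))"
begin

text \<open>The points \<open>p n i\<close> lie in \<open>D\<close>, where the sections of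
  \<open>f\<close> in \<open>y\<close> are continuous; this is the use made of the dense
  set.\<close>

lemma PP_sample_zero_set:
  fixes g :: "'c \<Rightarrow> real"
  assumes g: "continuous_map Z euclideanreal g" "\<And>z. 0 \<le> g z"
  shows "\<exists>s. continuous_map (prod_topology X Y) euclideanreal s \<and> (\<forall>t. 0 \<le> s t) \<and>
    (\<forall>x\<in>topspace X. \<forall>y. s (x, y) = 0 \<longleftrightarrow> (\<forall>i\<in>I n. x \<in> U n i \<longrightarrow> g (f (p n i, y)) = 0))"
proof (rule locally_finite_zero_set)
  show "locally_finite_family X (I n) (U n)" and "\<And>i. i \<in> I n \<Longrightarrow> cozero_in X (U n i)"
    using sys unfolding strong_PP_system_def by blast+
  fix i assume "i \<in> I n"
  then have "p n i \<in> D" using sys unfolding strong_PP_system_def by blast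
  then show "continuous_map Y euclideanreal (\<lambda>y. g (f (p n i, y)))"
    using continuous_map_compose[OF f2 g(1)] by (simp add: o_def)
qed (rule g(2))

text \<open>Continuity of \<open>f\<close> in the first variable transports the convergence of the
  points \<open>p n (s n)\<close> to \<open>x\<close>.\<close>

lemma PP_sample_limit:
  assumes "x \<in> topspace X" "y \<in> topspace Y" "\<And>n. s n \<in> I n \<and> x \<in> U n (s n)"
  shows "limitin Z (\<lambda>n. f (p n (s n), y)) (f (x, y)) sequentially"
proof -
  have "limitin X (\<lambda>n. p n (s n)) x sequentially"
    using sys assms(1,3) unfolding strong_PP_system_def by blast
  then show ?thesis using continuous_map_limit[OF f1[OF assms(2)]] by (simp add: o_def)
qed

lemma PP_index_exists: "x \<in> topspace X \<Longrightarrow> \<exists>i. i \<in> I n \<and> x \<in> U n i"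
  using sys unfolding strong_PP_system_def by blast

lemma PP_index_finite:
  assumes "x \<in> topspace X"
  shows "finite {i \<in> I n. x \<in> U n i}"
proof -
  have "locally_finite_family X (I n) (U n)" using sys unfolding strong_PP_system_def by blast
  then obtain V where V: "x \<in> V" "finite {i \<in> I n. U n i \<inter> V \<noteq> {}}"
    using assms unfolding locally_finite_family_def by blast
  then show ?thesis by (elim finite_subset[rotated]) blast
qed

lemma PP_sample_in_topspace:
  assumes "i \<in> I n" "y \<in> topspace Y"
  shows "f (p n i, y) \<in> topspace Z"
proof -
  have "p n i \<in> D" using sys assms(1) unfolding strong_PP_system_def by blast
  then show ?thesis using continuous_map_image_subset_topspace[OF f2] assms(2) by blast
qed

text \<open>\<open>g\<close> is positive at \<open>f (x, y)\<close> exactly if, for some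
  \<open>k\<close> and \<open>m\<close>, it is at least \<open>1 / real (Suc k)\<close> on all
  samples of the levels \<open>n \<ge> m\<close>. For fixed \<open>k\<close> and \<open>m\<close>
  this is a countable intersection of zero sets. One direction passes to the limit; for the other,
  exceptions at infinitely many levels would belong to one index sequence whose samples still
  converge.\<close>

lemma PP_preimage_zero_sigma:
  fixes g :: "'c \<Rightarrow> real"
  assumes g: "continuous_map Z euclideanreal g"
  shows "zero_sigma_in (prod_topology X Y) {t \<in> topspace (prod_topology X Y). 0 < g (f t)}"
proof -
  \<comment> \<open>Vanishes exactly where \<open>g z\<close> is at least
    \<open>1 / real (Suc k)\<close>.\<close>
  let ?b = "\<lambda>k z. max 0 (1 / real (Suc k) - g z)"
  have "\<forall>k n. \<exists>s. continuous_map (prod_topology X Y) euclideanreal s \<and> (\<forall>t. 0 \<le> s t) \<and>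
    (\<forall>x\<in>topspace X. \<forall>y. s (x, y) = 0 \<longleftrightarrow> (\<forall>i\<in>I n. x \<in> U n i \<longrightarrow> ?b k (f (p n i, y)) = 0))"
    by (intro allI PP_sample_zero_set continuous_map_real_max continuous_map_diff g) simp_all
  from choice[OF allI[OF choice[OF spec[OF this]]]] obtain s where
    s: "\<forall>k n. continuous_map (prod_topology X Y) euclideanreal (s k n) \<and> (\<forall>t. 0 \<le> s k n t) \<and>
    (\<forall>x\<in>topspace X. \<forall>y. s k n (x, y) = 0 \<longleftrightarrow> (\<forall>i\<in>I n. x \<in> U n i \<longrightarrow> ?b k (f (p n i, y)) = 0))" ..
  \<comment> \<open>\<open>l\<close> codes the pair of the bound \<open>k\<close> and the starting
    level \<open>m\<close> of the tail.\<close>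
  have "\<forall>l. \<exists>v. continuous_map (prod_topology X Y) euclideanreal v \<and> (\<forall>t. 0 \<le> v t) \<and>
    (\<forall>t. v t = 0 \<longleftrightarrow> (\<forall>n. s (fst (prod_decode l)) (snd (prod_decode l) + n) t = 0))"
  proof
    fix l
    obtain v where "continuous_map (prod_topology X Y) euclideanreal v" "\<And>t. 0 \<le> v t"
      "\<And>t. v t = 0 \<longleftrightarrow> (\<forall>n. s (fst (prod_decode l)) (snd (prod_decode l) + n) t = 0)"
      by (rule countable_zero_set_Inter[of "prod_topology X Y"
            "\<lambda>n. s (fst (prod_decode l)) (snd (prod_decode l) + n)"]) (use s in simp_all)
    then show "\<exists>v. continuous_map (prod_topology X Y) euclideanreal v \<and> (\<forall>t. 0 \<le> v t) \<and>
      (\<forall>t. v t = 0 \<longleftrightarrow> (\<forall>n. s (fst (prod_decode l)) (snd (prod_decode l) + n) t = 0))"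
      by (intro exI[of _ v]) simp
  qed
  from choice[OF this] obtain v where
    v: "\<forall>l. continuous_map (prod_topology X Y) euclideanreal (v l) \<and> (\<forall>t. 0 \<le> v l t) \<and>
    (\<forall>t. v l t = 0 \<longleftrightarrow> (\<forall>n. s (fst (prod_decode l)) (snd (prod_decode l) + n) t = 0))" ..
  have "0 < g (f (x, y)) \<longleftrightarrow> (\<exists>l. v l (x, y) = 0)" if x: "x \<in> topspace X" and y: "y \<in> topspace Y" for x y
  proof
    assume pos: "0 < g (f (x, y))"
    then obtain k where k: "1 / real (Suc k) < g (f (x, y))"
      by (rule nat_approx_posE)
    have "\<exists>m. \<forall>n\<ge>m. \<forall>i\<in>I n. x \<in> U n i \<longrightarrow> 1 / real (Suc k) < g (f (p n i, y))"
    proof (rule ccontr)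
      let ?bad = "\<lambda>n i. i \<in> I n \<and> x \<in> U n i \<and> g (f (p n i, y)) \<le> 1 / real (Suc k)"
      assume "\<not> ?thesis"
      then have bad: "\<forall>m. \<exists>n\<ge>m. \<exists>i. ?bad n i" by (meson not_less)
      \<comment> \<open>A bad index is taken wherever one exists and an arbitrary one elsewhere, so
        that a full sequence of indices results.\<close>
      have "\<forall>n. \<exists>i. (i \<in> I n \<and> x \<in> U n i) \<and> ((\<exists>j. ?bad n j) \<longrightarrow> ?bad n i)"
        using PP_index_exists[OF x] by blast
      from choice[OF this] obtain \<sigma> where
        \<sigma>: "\<forall>n. (\<sigma> n \<in> I n \<and> x \<in> U n (\<sigma> n)) \<and> ((\<exists>j. ?bad n j) \<longrightarrow> ?bad n (\<sigma> n))" ..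
      have "limitin Z (\<lambda>n. f (p n (\<sigma> n), y)) (f (x, y)) sequentially"
        by (rule PP_sample_limit[OF x y]) (use \<sigma> in blast)
      then have "(\<lambda>n. g (f (p n (\<sigma> n), y))) \<longlonglongrightarrow> g (f (x, y))"
        using continuous_map_limit[OF g] by (simp add: o_def)
      then have "\<forall>\<^sub>F n in sequentially. 1 / real (Suc k) < g (f (p n (\<sigma> n), y))"
        using k by (rule order_tendstoD)
      then obtain m where m: "\<And>n. n \<ge> m \<Longrightarrow> 1 / real (Suc k) < g (f (p n (\<sigma> n), y))"
        unfolding eventually_sequentially by auto
      obtain n where "n \<ge> m" "\<exists>i. ?bad n i" using bad by blast
      then have "g (f (p n (\<sigma> n), y)) \<le> 1 / real (Suc k)" using \<sigma> by blast
      then show False using m[OF \<open>n \<ge> m\<close>] by simp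
    qed
    then obtain m where m: "\<And>n i. \<lbrakk>n \<ge> m; i \<in> I n; x \<in> U n i\<rbrakk> \<Longrightarrow> 1 / real (Suc k) < g (f (p n i, y))"
      by blast
    have "s k (m + n) (x, y) = 0" for n
    proof -
      have "?b k (f (p (m + n) i, y)) = 0" if "i \<in> I (m + n)" "x \<in> U (m + n) i" for i
        using m[OF le_add1 that] by simp
      then show ?thesis using s x by simp
    qed
    then have "v (prod_encode (k, m)) (x, y) = 0" using v by simp
    then show "\<exists>l. v l (x, y) = 0" ..
  next
    assume "\<exists>l. v l (x, y) = 0"
    then obtain l where l: "v l (x, y) = 0" ..
    define k where "k = fst (prod_decode l)"
    define m where "m = snd (prod_decode l)"
    have s0: "s k (m + n) (x, y) = 0" for n using l v unfolding k_def m_def by simp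
    have b: "1 / real (Suc k) \<le> g (f (p n i, y))" if n: "n \<ge> m" and i: "i \<in> I n" "x \<in> U n i" for n i
    proof -
      have "s k n (x, y) = 0" using s0[of "n - m"] n by simp
      then have "?b k (f (p n i, y)) = 0" using s x i by blast
      then show ?thesis by linarith
    qed
    have "\<forall>n. \<exists>i. i \<in> I n \<and> x \<in> U n i" using PP_index_exists[OF x] by blast
    from choice[OF this] obtain \<sigma> where \<sigma>: "\<forall>n. \<sigma> n \<in> I n \<and> x \<in> U n (\<sigma> n)" ..
    have "limitin Z (\<lambda>n. f (p n (\<sigma> n), y)) (f (x, y)) sequentially"
      by (rule PP_sample_limit[OF x y]) (use \<sigma> in blast)
    then have "(\<lambda>n. g (f (p n (\<sigma> n), y))) \<longlonglongrightarrow> g (f (x, y))"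
      using continuous_map_limit[OF g] by (simp add: o_def)
    moreover have "\<forall>n\<ge>m. 1 / real (Suc k) \<le> g (f (p n (\<sigma> n), y))" using b \<sigma> by blast
    ultimately have "1 / real (Suc k) \<le> g (f (x, y))" by (intro LIMSEQ_le_const) auto
    moreover have "0 < 1 / real (Suc k)" by simp
    ultimately show "0 < g (f (x, y))" by linarith
  qed
  then have "{t \<in> topspace (prod_topology X Y). 0 < g (f t)} =
      {t \<in> topspace (prod_topology X Y). \<exists>l. v l t = 0}" by auto
  moreover have "\<forall>l. continuous_map (prod_topology X Y) euclideanreal (v l) \<and> (\<forall>t. 0 \<le> v l t)"
    using v by blast
  ultimately show ?thesis unfolding zero_sigma_in_def by blast
qed

text \<open>If \<open>C\<close> is the zero set of \<open>g\<close>, each level contributes a zero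
  set, and the levels are intersected.\<close>

lemma PP_closed_samples_zero_set:
  fixes g :: "'c \<Rightarrow> real"
  assumes g: "continuous_map Z euclideanreal g" "\<And>z. 0 \<le> g z"
    and gC: "\<And>z. z \<in> topspace Z \<Longrightarrow> g z = 0 \<longleftrightarrow> z \<in> C"
  shows "\<exists>v. continuous_map (prod_topology X Y) euclideanreal v \<and> (\<forall>t. 0 \<le> v t) \<and>
    (\<forall>x\<in>topspace X. \<forall>y\<in>topspace Y. v (x, y) = 0 \<longleftrightarrow>
       (\<forall>n. \<forall>i\<in>I n. x \<in> U n i \<longrightarrow> f (p n i, y) \<in> C))"
proof -
  have "\<forall>n. \<exists>s. continuous_map (prod_topology X Y) euclideanreal s \<and> (\<forall>t. 0 \<le> s t) \<and>
    (\<forall>x\<in>topspace X. \<forall>y. s (x, y) = 0 \<longleftrightarrow> (\<forall>i\<in>I n. x \<in> U n i \<longrightarrow> g (f (p n i, y)) = 0))"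
    by (intro allI PP_sample_zero_set g)
  from choice[OF this] obtain s where
    s: "\<forall>n. continuous_map (prod_topology X Y) euclideanreal (s n) \<and> (\<forall>t. 0 \<le> s n t) \<and>
    (\<forall>x\<in>topspace X. \<forall>y. s n (x, y) = 0 \<longleftrightarrow> (\<forall>i\<in>I n. x \<in> U n i \<longrightarrow> g (f (p n i, y)) = 0))" ..
  obtain v where v: "continuous_map (prod_topology X Y) euclideanreal v" "\<And>t. 0 \<le> v t"
    "\<And>t. v t = 0 \<longleftrightarrow> (\<forall>n. s n t = 0)"
    by (rule countable_zero_set_Inter[of "prod_topology X Y" s]) (use s in simp_all)
  have "v (x, y) = 0 \<longleftrightarrow> (\<forall>n. \<forall>i\<in>I n. x \<in> U n i \<longrightarrow> f (p n i, y) \<in> C)"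
    if "x \<in> topspace X" "y \<in> topspace Y" for x y
  proof -
    have "v (x, y) = 0 \<longleftrightarrow> (\<forall>n. \<forall>i\<in>I n. x \<in> U n i \<longrightarrow> g (f (p n i, y)) = 0)"
      using v(3) s that(1) by simp
    also have "\<dots> \<longleftrightarrow> (\<forall>n. \<forall>i\<in>I n. x \<in> U n i \<longrightarrow> f (p n i, y) \<in> C)"
      using gC PP_sample_in_topspace[OF _ that(2)] by auto
    finally show ?thesis .
  qed
  then show ?thesis using v by (intro exI[of _ v]) simp
qed

lemma PP_limit_in_closed:
  assumes x: "x \<in> topspace X" and y: "y \<in> topspace Y" and C: "closedin Z C"
    and "\<And>n i. \<lbrakk>i \<in> I n; x \<in> U n i\<rbrakk> \<Longrightarrow> f (p n i, y) \<in> C"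
  shows "f (x, y) \<in> C"
proof -
  have "\<forall>n. \<exists>i. i \<in> I n \<and> x \<in> U n i" using PP_index_exists[OF x] by blast
  from choice[OF this] obtain \<sigma> where \<sigma>: "\<forall>n. \<sigma> n \<in> I n \<and> x \<in> U n (\<sigma> n)" ..
  have "limitin Z (\<lambda>n. f (p n (\<sigma> n), y)) (f (x, y)) sequentially"
    by (rule PP_sample_limit[OF x y]) (use \<sigma> in blast)
  then show ?thesis
    by (rule limitin_closedin[OF _ C]) (use assms(4) \<sigma> in auto)
qed

text \<open>
  Choosing in every finite set \<open>{i \<in> I n. x \<in> U n i}\<close> an index whose sample lies latest in the
  stratification, a single convergent sequence controls all samples.
\<close>
lemma PP_samples_in_stratum:
  assumes Z: "strongly_sigma_metrizable Z Zs" and x: "x \<in> topspace X" and y: "y \<in> topspace Y"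
  shows "\<exists>m. \<forall>n. \<forall>i\<in>I n. x \<in> U n i \<longrightarrow> f (p n i, y) \<in> Zs m"
proof -
  have ZU: "topspace Z = (\<Union>n. Zs n)" and "\<And>n. Zs n \<subseteq> Zs (Suc n)"
    using Z unfolding strongly_sigma_metrizable_def sigma_metrizable_def by simp_all
  then have mono: "Zs m \<subseteq> Zs n" if "m \<le> n" for m n
    using lift_Suc_mono_le[of Zs m n] that by blast
  define \<rho> where "\<rho> z = (LEAST m. z \<in> Zs m)" for z
  have \<rho>: "z \<in> Zs (\<rho> z)" if "z \<in> topspace Z" for z
  proof -
    have "\<exists>m. z \<in> Zs m" using that unfolding ZU by simp
    then show ?thesis unfolding \<rho>_def by (rule LeastI_ex)
  qed
  have "\<forall>n. \<exists>i. (i \<in> I n \<and> x \<in> U n i) \<and>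
      (\<forall>j. j \<in> I n \<and> x \<in> U n j \<longrightarrow> \<rho> (f (p n j, y)) \<le> \<rho> (f (p n i, y)))"
  proof
    fix n
    let ?J = "{i \<in> I n. x \<in> U n i}" and ?r = "\<lambda>i. \<rho> (f (p n i, y))"
    have "?J \<noteq> {}" using PP_index_exists[OF x] by blast
    then have "Max (?r ` ?J) \<in> ?r ` ?J" using PP_index_finite[OF x] by (intro Max_in) auto
    then obtain i where i: "i \<in> ?J" "Max (?r ` ?J) = ?r i" by blast
    have "?r j \<le> ?r i" if "j \<in> ?J" for j
      unfolding i(2)[symmetric] using that PP_index_finite[OF x, of n] by (intro Max_ge) auto
    then show "\<exists>i. (i \<in> I n \<and> x \<in> U n i) \<and> (\<forall>j. j \<in> I n \<and> x \<in> U n j \<longrightarrow> ?r j \<le> ?r i)"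
      using i(1) by (intro exI[of _ i]) simp
  qed
  from choice[OF this] obtain \<sigma> where \<sigma>: "\<forall>n. (\<sigma> n \<in> I n \<and> x \<in> U n (\<sigma> n)) \<and>
      (\<forall>j. j \<in> I n \<and> x \<in> U n j \<longrightarrow> \<rho> (f (p n j, y)) \<le> \<rho> (f (p n (\<sigma> n), y)))" ..
  have "limitin Z (\<lambda>n. f (p n (\<sigma> n), y)) (f (x, y)) sequentially"
    by (rule PP_sample_limit[OF x y]) (use \<sigma> in blast)
  moreover have "range (\<lambda>n. f (p n (\<sigma> n), y)) \<subseteq> topspace Z"
    using PP_sample_in_topspace[OF _ y] \<sigma> by blast
  ultimately obtain m where m: "range (\<lambda>n. f (p n (\<sigma> n), y)) \<subseteq> Zs m"
    using Z unfolding strongly_sigma_metrizable_def by blast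
  \<comment> \<open>The chosen sample has the largest \<open>\<rho>\<close> of its level and lies in
    \<open>Zs m\<close>, so every sample of that level has \<open>\<rho>\<close> at most
    \<open>m\<close>.\<close>
  have "f (p n i, y) \<in> Zs m" if i: "i \<in> I n" "x \<in> U n i" for n i
  proof -
    have "\<rho> (f (p n i, y)) \<le> \<rho> (f (p n (\<sigma> n), y))" using \<sigma> i by blast
    also have "\<dots> \<le> m" unfolding \<rho>_def using m by (intro Least_le) blast
    finally show ?thesis using \<rho>[OF PP_sample_in_topspace[OF i(1) y]] mono by blast
  qed
  then show ?thesis by blast
qed

end

subsection \<open>Gluing the strata\<close>

text \<open>At stage \<open>N\<close> the map \<open>H m N\<close> is used where
  \<open>collar N v m\<close> is \<open>1\<close>, for \<open>m \<le> N\<close>; as the collar falls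
  to \<open>1/2\<close> the contraction moves its values to the point \<open>a\<close>, the common
  value outside all collars. At \<open>t\<close> the collar of the first \<open>m\<close> with
  \<open>v m t = 0\<close> is eventually \<open>1\<close>, so the glued maps eventually follow
  \<open>H m N\<close>.\<close>

lemma contractible_glue_limits:
  fixes v :: "nat \<Rightarrow> 'a \<Rightarrow> real" and H :: "nat \<Rightarrow> nat \<Rightarrow> 'a \<Rightarrow> 'c"
  assumes Z: "contractible_space Z" "topspace Z \<noteq> {}"
    and v: "\<And>m. continuous_map T euclideanreal (v m)" "\<And>m t. 0 \<le> v m t"
    and cover: "\<And>t. t \<in> topspace T \<Longrightarrow> \<exists>m. v m t = 0"
    and H: "\<And>m N. continuous_map T Z (H m N)"
    and lim: "\<And>m t. \<lbrakk>t \<in> topspace T; v m t = 0\<rbrakk> \<Longrightarrow> limitin Z (\<lambda>N. H m N t) (f t) sequentially"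
  shows "f \<in> baire_one T Z"
proof -
  obtain a \<gamma> where \<gamma>: "continuous_map (prod_topology (top_of_set {0..1::real}) Z) Z \<gamma>"
    "\<And>z. \<gamma> (0, z) = z" "\<And>z. \<gamma> (1, z) = a"
    using Z(1) unfolding contractible_space_def homotopic_with_def by (metis id_apply)
  \<comment> \<open>\<open>contractible_space\<close> also holds of the empty space; given a point
    of \<open>Z\<close>, the end of its track under \<open>\<gamma>\<close> is
    \<open>a\<close>.\<close>
  have a: "a \<in> topspace Z"
  proof -
    obtain z where "z \<in> topspace Z" using Z(2) by blast
    then have "(1, z) \<in> topspace (prod_topology (top_of_set {0..1::real}) Z)" by simp
    then have "\<gamma> (1, z) \<in> topspace Z"
      using continuous_map_image_subset_topspace[OF \<gamma>(1)] by blast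
    then show ?thesis by (simp add: \<gamma>(3))
  qed
  have "\<forall>N. \<exists>F. continuous_map T Z F \<and>
    (\<forall>t\<in>topspace T. \<forall>m\<le>N. collar N v m t = 1 \<longrightarrow> F t = H m N t)"
  proof
    fix N
    \<comment> \<open>Contraction time: \<open>0\<close> where the collar is \<open>1\<close>, and
      \<open>1\<close> as soon as it is at most \<open>1/2\<close>.\<close>
    define c where "c m t = max 0 (min 1 (2 - 2 * collar N v m t))" for m t
    have cont_c: "continuous_map T (top_of_set {0..1}) (c m)" for m
      unfolding continuous_map_in_subtopology
    proof
      show "continuous_map T euclideanreal (c m)"
        unfolding c_def[abs_def]
        by (intro continuous_map_real_max continuous_map_real_min continuous_map_diff
            continuous_map_real_mult_left continuous_map_collar v) simp_all
    qed (simp add: c_def)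
    define P where "P m t = \<gamma> (c m t, H m N t)" for m t
    have P: "continuous_map T Z (P m)" for m
      using continuous_map_compose[OF continuous_map_pairedI[OF cont_c H] \<gamma>(1)]
      unfolding P_def[abs_def] by (simp add: o_def)
    have collar_cont: "continuous_map T euclideanreal (collar N v m)" for m
      by (rule continuous_map_collar[OF v(1)])
    obtain F where F: "continuous_map T Z F"
      "\<And>m t. \<lbrakk>m \<in> {..N}; t \<in> topspace T; 0 < collar N v m t\<rbrakk> \<Longrightarrow> F t = P m t"
    proof (rule glue_disjoint_supports[where S="{..N}" and q="collar N v" and h="\<lambda>_. a" and P=P
          and T=T and Z=Z])
      fix m t assume "collar N v m t \<le> 1/2"
      then have "c m t = 1" by (simp add: c_def)
      then show "P m t = a" by (simp add: P_def \<gamma>(3))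
    next
      fix m n t assume "m \<noteq> n" "0 < collar N v m t"
      then show "collar N v n t \<le> 0" using collar_disjoint by fastforce
    next
      fix F assume "continuous_map T Z F"
        "\<And>m t. \<lbrakk>m \<in> {..N}; t \<in> topspace T; 0 < collar N v m t\<rbrakk> \<Longrightarrow> F t = P m t"
      then show thesis by (rule that)
    qed (use a P collar_cont in auto)
    have "F t = H m N t" if "t \<in> topspace T" "m \<le> N" "collar N v m t = 1" for t m
      using F(2)[of m t] that by (simp add: P_def c_def \<gamma>(2))
    then show "\<exists>F. continuous_map T Z F \<and>
        (\<forall>t\<in>topspace T. \<forall>m\<le>N. collar N v m t = 1 \<longrightarrow> F t = H m N t)"
      using F(1) by blast
  qed
  from choice[OF this] obtain F where F: "\<forall>N. continuous_map T Z (F N) \<and>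
    (\<forall>t\<in>topspace T. \<forall>m\<le>N. collar N v m t = 1 \<longrightarrow> F N t = H m N t)" ..
  have "limitin Z (\<lambda>N. F N t) (f t) sequentially" if t: "t \<in> topspace T" for t
  proof -
    define m where "m = (LEAST m. v m t = 0)"
    have vm: "v m t = 0" unfolding m_def using cover[OF t] by (rule LeastI_ex)
    have "0 < v k t" if "k < m" for k
      using not_less_Least[OF that[unfolded m_def]] v(2)[of k t] by linarith
    then have "\<forall>\<^sub>F N in sequentially. collar N v m t = 1"
      using eventually_collar_eq_1[of v, OF vm] by blast
    then have "\<forall>\<^sub>F N in sequentially. H m N t = F N t"
      using eventually_ge_at_top[of m] by eventually_elim (use F t in auto)
    then show ?thesis using lim[OF t vm] by (rule limitin_transform_eventually)
  qed
  then show ?thesis using F unfolding baire_one_def by blast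
qed

section \<open>Covering the product by zero sets over the strata and gluing the limits\<close>

theorem corollary5p7:
  fixes X :: "'a topology" and Y :: "'b topology" and Z :: "'c topology"
    and Zs :: "nat \<Rightarrow> 'c set"
  assumes "strong_PP_space X"
    and "topspace Z \<noteq> {}" and "contractible_space Z"
    and "regular_space Z"
    and "strongly_sigma_metrizable Z Zs"
    and "\<And>n. metrizable_space (subtopology Z (Zs n))"
    and "\<And>n. separable_space (subtopology Z (Zs n))"
    and "\<And>n. path_connected_space (subtopology Z (Zs n))"
    and "\<And>n. locally_path_connected_space (subtopology Z (Zs n))"
  shows "vertically_nearly_separately_continuous X Y Z \<subseteq> baire_one (prod_topology X Y) Z"
proof
  fix f :: "'a \<times> 'b \<Rightarrow> 'c"
  assume "f \<in> vertically_nearly_separately_continuous X Y Z"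
  then obtain D where f1: "\<And>y. y \<in> topspace Y \<Longrightarrow> continuous_map X Z (\<lambda>x. f (x, y))"
    and D: "D \<subseteq> topspace X" "X closure_of D = topspace X"
    and f2: "\<And>x. x \<in> D \<Longrightarrow> continuous_map Y Z (\<lambda>y. f (x, y))"
    unfolding vertically_nearly_separately_continuous_def by blast
  obtain I :: "nat \<Rightarrow> ('a \<times> nat) set" and U p where sys: "strong_PP_system X D I U p"
    using assms(1) D unfolding strong_PP_space_def by blast
  interpret strong_PP_sampling X Y Z D I U p f
    by unfold_locales (use sys f1 f2 in auto)
  let ?T = "prod_topology X Y"
  have ZU: "topspace Z = (\<Union>n. Zs n)" and clo: "closedin Z (Zs m)" for m
    using assms(5) unfolding strongly_sigma_metrizable_def sigma_metrizable_def by simp_all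
  have cozero: "\<exists>g :: 'c \<Rightarrow> real. continuous_map Z euclideanreal g \<and> (\<forall>z. 0 \<le> g z) \<and>
      (\<forall>z\<in>topspace Z. g z = 0 \<longleftrightarrow> z \<notin> W)" if W: "openin Z W" for W
  proof -
    obtain g :: "'c \<Rightarrow> real" where "continuous_map Z euclideanreal g" "\<And>z. 0 \<le> g z"
      "\<And>z. z \<in> topspace Z \<Longrightarrow> g z = 0 \<longleftrightarrow> z \<notin> W"
      using regular_Lindelof_imp_cozero[OF assms(4)
          sigma_separable_hereditarily_Lindelof[OF ZU assms(6,7)] W] by blast
    then show ?thesis by blast
  qed
  have "\<forall>m. \<exists>v. continuous_map ?T euclideanreal v \<and> (\<forall>t. 0 \<le> v t) \<and>
    (\<forall>x\<in>topspace X. \<forall>y\<in>topspace Y. v (x, y) = 0 \<longleftrightarrow>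
       (\<forall>n. \<forall>i\<in>I n. x \<in> U n i \<longrightarrow> f (p n i, y) \<in> Zs m))"
  proof
    fix m
    obtain g :: "'c \<Rightarrow> real" where "continuous_map Z euclideanreal g" "\<And>z. 0 \<le> g z"
      "\<And>z. z \<in> topspace Z \<Longrightarrow> g z = 0 \<longleftrightarrow> z \<in> Zs m"
      \<comment> \<open>Applied to the open complement, this turns the closed stratum into a zero
        set.\<close>
      using cozero[OF openin_diff[OF openin_topspace clo[of m]]] by auto
    then show "\<exists>v. continuous_map ?T euclideanreal v \<and> (\<forall>t. 0 \<le> v t) \<and>
    (\<forall>x\<in>topspace X. \<forall>y\<in>topspace Y. v (x, y) = 0 \<longleftrightarrow>
       (\<forall>n. \<forall>i\<in>I n. x \<in> U n i \<longrightarrow> f (p n i, y) \<in> Zs m))"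
      by (rule PP_closed_samples_zero_set)
  qed
  from choice[OF this] obtain v where v: "\<forall>m. continuous_map ?T euclideanreal (v m) \<and> (\<forall>t. 0 \<le> v m t) \<and>
    (\<forall>x\<in>topspace X. \<forall>y\<in>topspace Y. v m (x, y) = 0 \<longleftrightarrow>
       (\<forall>n. \<forall>i\<in>I n. x \<in> U n i \<longrightarrow> f (p n i, y) \<in> Zs m))" ..
  have v0: "v m (x, y) = 0 \<longleftrightarrow> (\<forall>n. \<forall>i\<in>I n. x \<in> U n i \<longrightarrow> f (p n i, y) \<in> Zs m)"
    if "x \<in> topspace X" "y \<in> topspace Y" for m x y
    using bspec[OF bspec[OF conjunct2[OF conjunct2[OF spec[OF v]]] that(1)] that(2)] .
  have v: "continuous_map ?T euclideanreal (v m)" "0 \<le> v m t" for m t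
    using v by blast+
  \<comment> \<open>\<open>A m\<close> is defined through the samples and may be smaller than the
    preimage of \<open>Zs m\<close> under \<open>f\<close>; in return it is a zero set.\<close>
  define A where "A m = {t \<in> topspace ?T. v m t = 0}" for m
  have cover: "\<exists>m. v m t = 0" if "t \<in> topspace ?T" for t
  proof -
    obtain x y where t: "t = (x, y)" "x \<in> topspace X" "y \<in> topspace Y" using \<open>t \<in> topspace ?T\<close> by auto
    then obtain m where "\<forall>n. \<forall>i\<in>I n. x \<in> U n i \<longrightarrow> f (p n i, y) \<in> Zs m"
      using PP_samples_in_stratum[OF assms(5)] by blast
    then have "v m t = 0" unfolding t(1) v0[OF t(2,3)] .
    then show ?thesis ..
  qed
  have fA: "f t \<in> Zs m" if t: "t \<in> A m" for t m
  proof -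
    obtain x y where xy: "t = (x, y)" "x \<in> topspace X" "y \<in> topspace Y" using t by (auto simp: A_def)
    have "\<forall>n. \<forall>i\<in>I n. x \<in> U n i \<longrightarrow> f (p n i, y) \<in> Zs m"
      using t unfolding A_def xy(1) mem_Collect_eq v0[OF xy(2,3)] by (rule conjunct2)
    then have "f (p n i, y) \<in> Zs m" if "i \<in> I n" "x \<in> U n i" for n i
      using that by blast
    then show ?thesis unfolding xy(1) by (rule PP_limit_in_closed[OF xy(2,3) clo])
  qed
  have f_top: "f t \<in> topspace Z" if "t \<in> topspace ?T" for t
    using that continuous_map_image_subset_topspace[OF f1] by fastforce
  \<comment> \<open>On \<open>A m\<close> the values of \<open>f\<close> lie in \<open>Zs m\<close>,
    so membership in \<open>V\<close> is membership in the open set \<open>W\<close> of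
    \<open>Z\<close>, and the co-zero function of \<open>W\<close> applies.\<close>
  have sigma: "zero_sigma_in ?T {t \<in> A m. f t \<in> V}" if "openin (subtopology Z (Zs m)) V" for m V
  proof -
    obtain W where W: "openin Z W" "V = W \<inter> Zs m"
      using \<open>openin (subtopology Z (Zs m)) V\<close> by (auto simp: openin_subtopology)
    obtain g :: "'c \<Rightarrow> real" where g: "continuous_map Z euclideanreal g" "\<And>z. 0 \<le> g z"
      "\<And>z. z \<in> topspace Z \<Longrightarrow> g z = 0 \<longleftrightarrow> z \<notin> W"
      using cozero[OF W(1)] by auto
    have gW: "0 < g z \<longleftrightarrow> z \<in> W" if "z \<in> topspace Z" for z
      using g(2)[of z] g(3)[OF that] by auto
    have "zero_sigma_in ?T {t \<in> topspace ?T. 0 < g (f t)}" using g(1) by (rule PP_preimage_zero_sigma)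
    then have "zero_sigma_in ?T {t \<in> {t \<in> topspace ?T. 0 < g (f t)}. v m t = 0}"
      by (rule zero_sigma_in_Int_zero_set) (rule v)+
    also have "{t \<in> {t \<in> topspace ?T. 0 < g (f t)}. v m t = 0} = {t \<in> A m. f t \<in> V}"
      using gW f_top fA unfolding A_def W(2) by blast
    finally show ?thesis .
  qed
  have "\<forall>m. \<exists>H :: nat \<Rightarrow> 'a \<times> 'b \<Rightarrow> 'c. (\<forall>N. continuous_map ?T Z (H N)) \<and>
      (\<forall>t\<in>A m. limitin Z (\<lambda>N. H N t) (f t) sequentially)"
  proof
    fix m
    have top: "topspace (subtopology Z (Zs m)) = Zs m" using ZU by auto
    show "\<exists>H :: nat \<Rightarrow> 'a \<times> 'b \<Rightarrow> 'c. (\<forall>N. continuous_map ?T Z (H N)) \<and>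
      (\<forall>t\<in>A m. limitin Z (\<lambda>N. H N t) (f t) sequentially)"
    \<comment> \<open>Initial strata may be empty; then \<open>A m\<close> is empty and any constant
      maps serve.\<close>
    proof (cases "Zs m = {}")
      case True
      then have "A m = {}" using fA by blast
      moreover obtain z where "z \<in> topspace Z" using assms(2) by blast
      ultimately show ?thesis by (intro exI[of _ "\<lambda>_ _. z"]) simp
    next
      case False
      have "\<exists>H :: nat \<Rightarrow> 'a \<times> 'b \<Rightarrow> 'c. (\<forall>N. continuous_map ?T (subtopology Z (Zs m)) (H N)) \<and>
          (\<forall>t\<in>A m. limitin (subtopology Z (Zs m)) (\<lambda>N. H N t) (f t) sequentially)"
      proof (rule zero_sigma_preimages_imp_limit)
        show "second_countable (subtopology Z (Zs m))"
          by (rule separable_metrizable_imp_second_countable[OF assms(6,7)])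
        show "topspace (subtopology Z (Zs m)) \<noteq> {}" unfolding top by (rule False)
        show "f \<in> A m \<rightarrow> topspace (subtopology Z (Zs m))" unfolding top using fA by blast
      qed (fact assms(6,8,9) sigma)+
      then show ?thesis
        unfolding limitin_subtopology continuous_map_in_subtopology by blast
    qed
  qed
  from choice[OF this] obtain H :: "nat \<Rightarrow> nat \<Rightarrow> 'a \<times> 'b \<Rightarrow> 'c" where
    H: "\<forall>m. (\<forall>N. continuous_map ?T Z (H m N)) \<and>
      (\<forall>t\<in>A m. limitin Z (\<lambda>N. H m N t) (f t) sequentially)" ..
  show "f \<in> baire_one ?T Z"
    by (rule contractible_glue_limits[OF assms(3,2), where v=v and H=H])
      (use v cover H in \<open>auto simp: A_def\<close>)
qed

end
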